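(* Let $\Omega$ be a countable set and let $P$ and $Q$ be stochastic matrices over $\Omega$. If $\varphi:\mathcal{T}_+(Q)\to\mathcal{T}_+(P)$ is an algebraic isomorphism, then $\varphi$ is bounded.
   Context: A stochastic matrix over $\Omega$ is $P:\Omega\times\Omega\to[0,\infty)$ with row sums $1$; $P^{(n)}_{ij}$ is the $(i,j)$ entry of $P^n$. $Arv(P)$: $Arv(P)_0=\ell^\infty(\Omega)$; for $n\ge1$, $Arv(P)_n$ is the set of complex $\Omega\times\Omega$ matrices $A=[a_{ij}]$ with $a_{ij}=0$ whenever $P^{(n)}_{ij}=0$ and $\sup_j\sum_i|a_{ij}|^2<\infty$, a W*-correspondence over $\ell^\infty(\Omega)$ (actions by multiplication by diagonal matrices, inner product $\mathrm{Diag}(A^*B)$), with maps $U_{n,m}(A\otimes B)=(\sqrt{P^{n+m}})^{\flat}*[(\sqrt{P^n}*A)(\sqrt{P^m}*B)]$ for $n,m\ge1$ ($*$ entrywise product, $\sqrt\cdot$ entrywise, $M^\flat_{ik}=M_{ik}^{-1}$ if $M_{ik}>0$, else $0$), and $U_{0,n},U_{n,0}$ the module actions. With $\mathcal{F}=\bigoplus_{n\ge0}Arv(P)_n$ (ultraweak direct sum) and shifts $S^{(n)}_A(B)=U_{n,m}(A\otimes B)$, the tensor algebra $\mathcal{T}_+(P)$ is the norm-closed subalgebra of $\mathcal{L}(\mathcal{F})$ generated by $\ell^\infty(\Omega)$ and all shifts, with the operator norm. *)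

theory Defs
  imports "HOL-Analysis.Analysis" "HOL-Library.Extended_Nonnegative_Real"
begin

definition stochastic :: "('a \<Rightarrow> 'a \<Rightarrow> real) \<Rightarrow> bool" where
  "stochastic P \<longleftrightarrow> (\<forall>i j. 0 \<le> P i j) \<and> (\<forall>i. ((\<lambda>j. P i j) has_sum 1) UNIV)"

fun mpow :: "('a \<Rightarrow> 'a \<Rightarrow> real) \<Rightarrow> nat \<Rightarrow> 'a \<Rightarrow> 'a \<Rightarrow> real" where
  "mpow P 0 = (\<lambda>i j. if i = j then 1 else 0)"
| "mpow P (Suc n) = (\<lambda>i k. \<Sum>\<^sub>\<infinity>j. mpow P n i j * P j k)"

definition cmmult :: "('a \<Rightarrow> 'a \<Rightarrow> complex) \<Rightarrow> ('a \<Rightarrow> 'a \<Rightarrow> complex) \<Rightarrow> 'a \<Rightarrow> 'a \<Rightarrow> complex" where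
  "cmmult X Y = (\<lambda>i k. \<Sum>\<^sub>\<infinity>j. X i j * Y j k)"

definition colbound :: "('a \<Rightarrow> 'a \<Rightarrow> complex) \<Rightarrow> ennreal" where
  "colbound A = (SUP j. \<Sum>\<^sub>\<infinity>i. ennreal ((cmod (A i j))\<^sup>2))"

definition arv :: "('a \<Rightarrow> 'a \<Rightarrow> real) \<Rightarrow> nat \<Rightarrow> ('a \<Rightarrow> 'a \<Rightarrow> complex) set" where
  "arv P n = {A. (\<forall>i j. mpow P n i j = 0 \<longrightarrow> A i j = 0) \<and> colbound A < \<infinity>}"

definition Umap :: "('a \<Rightarrow> 'a \<Rightarrow> real) \<Rightarrow> nat \<Rightarrow> nat \<Rightarrow> ('a \<Rightarrow> 'a \<Rightarrow> complex)
    \<Rightarrow> ('a \<Rightarrow> 'a \<Rightarrow> complex) \<Rightarrow> 'a \<Rightarrow> 'a \<Rightarrow> complex" where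
  "Umap P n m A B = (\<lambda>i k.
     if 0 < mpow P (n + m) i k then
       cmmult (\<lambda>i j. complex_of_real (sqrt (mpow P n i j)) * A i j)
              (\<lambda>j k. complex_of_real (sqrt (mpow P m j k)) * B j k) i k
       / complex_of_real (sqrt (mpow P (n + m) i k))
     else 0)"

text \<open>Elements of the Fock space: sequences xi with xi n in Arv(P)_n
  (Arv(P)_0 = l^infty(Omega) being the diagonal matrices, i.e. support in P^0 = I),
  whose inner products sum ultraweakly: sup_j sum_{n,i} |xi_n(i,j)|^2 < infinity.\<close>
type_synonym 'a fock_vec = "nat \<Rightarrow> 'a \<Rightarrow> 'a \<Rightarrow> complex"

definition fock_sq :: "'a fock_vec \<Rightarrow> ennreal" where
  "fock_sq \<xi> = (SUP j. infsum (\<lambda>(n, i). ennreal ((cmod (\<xi> n i j))\<^sup>2)) UNIV)"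

definition fock :: "('a \<Rightarrow> 'a \<Rightarrow> real) \<Rightarrow> 'a fock_vec set" where
  "fock P = {\<xi>. (\<forall>n i j. mpow P n i j = 0 \<longrightarrow> \<xi> n i j = 0) \<and> fock_sq \<xi> < \<infinity>}"

text \<open>Module norm ||<xi,xi>||^{1/2}.\<close>
definition fnorm :: "'a fock_vec \<Rightarrow> real" where
  "fnorm \<xi> = sqrt (enn2real (fock_sq \<xi>))"

definition fzero :: "'a fock_vec" where
  "fzero = (\<lambda>n i j. 0)"

text \<open>Operators on the Fock space are represented by HOL functions, normalised to be
  zero outside the Fock space.\<close>
definition restr :: "('a \<Rightarrow> 'a \<Rightarrow> real) \<Rightarrow> ('a fock_vec \<Rightarrow> 'a fock_vec) \<Rightarrow> 'a fock_vec \<Rightarrow> 'a fock_vec" where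
  "restr P f = (\<lambda>\<xi>. if \<xi> \<in> fock P then f \<xi> else fzero)"

definition bops :: "('a \<Rightarrow> 'a \<Rightarrow> real) \<Rightarrow> ('a fock_vec \<Rightarrow> 'a fock_vec) set" where
  "bops P = {T. (\<forall>\<xi>. \<xi> \<notin> fock P \<longrightarrow> T \<xi> = fzero)
      \<and> (\<forall>\<xi>\<in>fock P. T \<xi> \<in> fock P)
      \<and> (\<forall>\<xi>\<in>fock P. \<forall>\<eta>\<in>fock P. T (\<lambda>n i j. \<xi> n i j + \<eta> n i j) = (\<lambda>n i j. T \<xi> n i j + T \<eta> n i j))
      \<and> (\<forall>\<xi>\<in>fock P. \<forall>c::complex. T (\<lambda>n i j. c * \<xi> n i j) = (\<lambda>n i j. c * T \<xi> n i j))
      \<and> (\<exists>C. \<forall>\<xi>\<in>fock P. fnorm (T \<xi>) \<le> C * fnorm \<xi>)}"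

definition op_norm :: "('a \<Rightarrow> 'a \<Rightarrow> real) \<Rightarrow> ('a fock_vec \<Rightarrow> 'a fock_vec) \<Rightarrow> real" where
  "op_norm P T = Sup {fnorm (T \<xi>) | \<xi>. \<xi> \<in> fock P \<and> fnorm \<xi> \<le> 1}"

definition lmult :: "('a \<Rightarrow> complex) \<Rightarrow> 'a fock_vec \<Rightarrow> 'a fock_vec" where
  "lmult a \<xi> = (\<lambda>k i j. a i * \<xi> k i j)"

definition shift :: "('a \<Rightarrow> 'a \<Rightarrow> real) \<Rightarrow> nat \<Rightarrow> ('a \<Rightarrow> 'a \<Rightarrow> complex) \<Rightarrow> 'a fock_vec \<Rightarrow> 'a fock_vec" where
  "shift P n A \<xi> = (\<lambda>k. if k < n then (\<lambda>i j. 0) else Umap P n (k - n) A (\<xi> (k - n)))"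

inductive_set gen_alg :: "('a \<Rightarrow> 'a \<Rightarrow> real) \<Rightarrow> ('a fock_vec \<Rightarrow> 'a fock_vec) set"
  for P :: "'a \<Rightarrow> 'a \<Rightarrow> real" where
  gen_lmult: "bdd_above (range (\<lambda>i. cmod (a i))) \<Longrightarrow> restr P (lmult a) \<in> gen_alg P"
| gen_shift: "1 \<le> n \<Longrightarrow> A \<in> arv P n \<Longrightarrow> restr P (shift P n A) \<in> gen_alg P"
| gen_add: "S \<in> gen_alg P \<Longrightarrow> T \<in> gen_alg P \<Longrightarrow> (\<lambda>\<xi> n i j. S \<xi> n i j + T \<xi> n i j) \<in> gen_alg P"
| gen_smult: "S \<in> gen_alg P \<Longrightarrow> (\<lambda>\<xi> n i j. c * S \<xi> n i j) \<in> gen_alg P"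
| gen_mult: "S \<in> gen_alg P \<Longrightarrow> T \<in> gen_alg P \<Longrightarrow> S \<circ> T \<in> gen_alg P"

definition tensor_alg :: "('a \<Rightarrow> 'a \<Rightarrow> real) \<Rightarrow> ('a fock_vec \<Rightarrow> 'a fock_vec) set" where
  "tensor_alg P = {T \<in> bops P. \<forall>\<epsilon>>0. \<exists>S\<in>gen_alg P. S \<in> bops P \<and>
       op_norm P (\<lambda>\<xi> n i j. T \<xi> n i j - S \<xi> n i j) < \<epsilon>}"

definition alg_iso :: "('a \<Rightarrow> 'a \<Rightarrow> real) \<Rightarrow> ('a \<Rightarrow> 'a \<Rightarrow> real)
   \<Rightarrow> (('a fock_vec \<Rightarrow> 'a fock_vec) \<Rightarrow> ('a fock_vec \<Rightarrow> 'a fock_vec)) \<Rightarrow> bool" where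
  "alg_iso Q P \<phi> \<longleftrightarrow> bij_betw \<phi> (tensor_alg Q) (tensor_alg P)
     \<and> (\<forall>S\<in>tensor_alg Q. \<forall>T\<in>tensor_alg Q.
          \<phi> (\<lambda>\<xi> n i j. S \<xi> n i j + T \<xi> n i j) = (\<lambda>\<xi> n i j. \<phi> S \<xi> n i j + \<phi> T \<xi> n i j))
     \<and> (\<forall>S\<in>tensor_alg Q. \<forall>c::complex.
          \<phi> (\<lambda>\<xi> n i j. c * S \<xi> n i j) = (\<lambda>\<xi> n i j. c * \<phi> S \<xi> n i j))
     \<and> (\<forall>S\<in>tensor_alg Q. \<forall>T\<in>tensor_alg Q. \<phi> (S \<circ> T) = \<phi> S \<circ> \<phi> T)"

end

(*
Automatic continuity by gliding humps. An element T of the tensor algebra of P is determined by its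
coefficients coef T d i k = (T \<Omega>_k) d i k with \<Omega>_k the vacuum vector at k, because T commutes with the
"right creation operators" rcreate. Call a state k bad if some coefficient functional
a \<mapsto> coef (\<phi> a) d i k is unbounded.

Were infinitely many states bad, their vertex projections would pull back along \<phi> to mutually
annihilating elements b_n, and x = sum a_n b_n with suitable small a_n would make the coefficients of
\<phi> x unbounded. Right multiplication by a matrix-unit shift along an edge k -> l moves badness from k
to l, so a nonempty finite set of bad states contains a state r on a cycle, of length p say. Let
\<phi> b = S_E for the matrix unit E = E_rr in degree p, fix the row i and take the least degree d whose
functional is unbounded: for x = sum a_n b^n the tail beyond n has the form y b^(n+1) and contributes
to degree d + np only through a functional of degree below d, which is bounded. Again the a_n can be
chosen such that the coefficients of \<phi> x are unbounded. Hence all coefficient functionals are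
bounded, and the uniform boundedness principle gives the claim.
*)
theory Submission
  imports Defs "HOL-Library.Function_Algebras"
begin

section \<open>The Fock space as a normed space\<close>

text \<open>The obstacle is that \<open>\<phi>\<close> is not known to respect limits, so it can
  never be applied to a series term by term. Both hump arguments about \<open>\<phi>\<close>
  therefore split the limit as x = s + t with s a finite partial sum, and treat t by an exact
  identity in the algebra over \<open>Q\<close>. Such an identity involves finitely many elements
  only and is transported by \<open>\<phi>\<close>. On a cycle the loss caused by the tail must
  moreover be known before a_n is chosen; the weights are arranged so that the quotient y has norm
  at most 4/3 whatever the choices are.

  Finiteness of the bad set has to come first because a walk through infinitely many states may
  never return, and only a return gives a shift whose powers can be used.

  The final passage to the norm goes column by column. The norm is a supremum over columns, so
  finitely supported vectors need not approximate a Fock vector, but they do approximate each single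
  column.\<close>

definition fbound :: "'a fock_vec \<Rightarrow> real \<Rightarrow> bool" where
  "fbound \<xi> c \<longleftrightarrow> (\<forall>j G. finite G \<longrightarrow> L2_set (\<lambda>(n, i). cmod (\<xi> n i j)) G \<le> c)"

text \<open>Vectors and operators are added and subtracted by the pointwise operations of
  \<open>Function_Algebras\<close>; scalar multiples get the named constants \<open>fscale\<close>
  and \<open>oscale\<close>, so that the explicit lambdas in \<open>bops\<close>,
  \<open>gen_alg\<close> and \<open>alg_iso\<close> fold into ordinary algebra.\<close>

definition fscale :: "complex \<Rightarrow> 'a fock_vec \<Rightarrow> 'a fock_vec" where
  "fscale c \<xi> = (\<lambda>n i j. c * \<xi> n i j)"

lemma fscale_apply [simp]: "fscale c \<xi> n i j = c * \<xi> n i j"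
  by (simp add: fscale_def)

lemma fzero_eq_0: "fzero = 0"
  by (simp add: fzero_def zero_fun_def)

text \<open>A nonnegative infinite sum is the supremum of its finite partial sums. Later arguments
  use \<open>fbound\<close>: on finite sets the triangle inequality is real-valued, and bounds pass
  to coordinatewise limits.\<close>

lemma fock_sq_le_iff:
  assumes "0 \<le> c"
  shows "fock_sq \<xi> \<le> ennreal (c\<^sup>2) \<longleftrightarrow> fbound \<xi> c"
proof -
  have "(infsum (\<lambda>(n, i). ennreal ((cmod (\<xi> n i j))\<^sup>2)) UNIV \<le> ennreal (c\<^sup>2)) \<longleftrightarrow>
      (\<forall>G. finite G \<longrightarrow> L2_set (\<lambda>(n, i). cmod (\<xi> n i j)) G \<le> c)" for j
  proof -
    have "infsum (\<lambda>(n, i). ennreal ((cmod (\<xi> n i j))\<^sup>2)) UNIV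
        = (SUP F\<in>{F. finite F \<and> F\<subseteq>UNIV}. \<Sum>(n, i)\<in>F. ennreal ((cmod (\<xi> n i j))\<^sup>2))"
      by (rule nonneg_infsum_complete) auto
    moreover have "(\<Sum>(n, i)\<in>F. ennreal ((cmod (\<xi> n i j))\<^sup>2))
        = ennreal (\<Sum>(n, i)\<in>F. (cmod (\<xi> n i j))\<^sup>2)" for F
      by (subst sum_ennreal[symmetric]) (auto simp: case_prod_unfold)
    moreover have "(\<Sum>(n, i)\<in>F. (cmod (\<xi> n i j))\<^sup>2) \<le> c\<^sup>2 \<longleftrightarrow>
        L2_set (\<lambda>(n, i). cmod (\<xi> n i j)) F \<le> c" for F
    proof -
      have "(\<Sum>(n, i)\<in>F. (cmod (\<xi> n i j))\<^sup>2) = (L2_set (\<lambda>(n, i). cmod (\<xi> n i j)) F)\<^sup>2"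
        by (simp add: L2_set_def case_prod_unfold sum_nonneg)
      then show ?thesis
        using assms by (metis L2_set_nonneg abs_le_square_iff abs_of_nonneg)
    qed
    ultimately show ?thesis
      by (simp add: SUP_le_iff ennreal_le_iff)
  qed
  then show ?thesis
    by (simp add: fock_sq_def SUP_le_iff fbound_def)
qed

lemma fbound_nonneg: "fbound \<xi> c \<Longrightarrow> 0 \<le> c"
  unfolding fbound_def by (metis L2_set_empty finite.emptyI)

lemma fock_iff: "\<xi> \<in> fock P \<longleftrightarrow> (\<forall>n i j. mpow P n i j = 0 \<longrightarrow> \<xi> n i j = 0) \<and> (\<exists>c. fbound \<xi> c)"
proof -
  have "fock_sq \<xi> < \<infinity> \<longleftrightarrow> (\<exists>c. fbound \<xi> c)"
  proof
    assume "fock_sq \<xi> < \<infinity>"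
    then have "fock_sq \<xi> = ennreal ((sqrt (enn2real (fock_sq \<xi>)))\<^sup>2)"
      by simp
    then show "\<exists>c. fbound \<xi> c"
      using fock_sq_le_iff[of "sqrt (enn2real (fock_sq \<xi>))" \<xi>] by auto
  next
    assume "\<exists>c. fbound \<xi> c"
    then obtain c where "fbound \<xi> c" by blast
    then have "fock_sq \<xi> \<le> ennreal (c\<^sup>2)"
      using fock_sq_le_iff fbound_nonneg by blast
    then show "fock_sq \<xi> < \<infinity>"
      using ennreal_less_top infinity_ennreal_def order_le_less_trans by metis
  qed
  then show ?thesis by (simp add: fock_def)
qed

lemma fnorm_nonneg [simp]: "0 \<le> fnorm \<xi>"
  by (simp add: fnorm_def)

lemma fnorm_le: "fbound \<xi> c \<Longrightarrow> fnorm \<xi> \<le> c"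
  unfolding fnorm_def
  by (metis enn2real_leI fbound_nonneg fock_sq_le_iff real_sqrt_abs abs_of_nonneg
      real_sqrt_le_iff zero_le_power2)

lemma fbound_fnorm: "\<xi> \<in> fock P \<Longrightarrow> fbound \<xi> (fnorm \<xi>)"
  using fock_sq_le_iff[of "fnorm \<xi>" \<xi>] by (simp add: fock_def fnorm_def)

lemma fbound_add: "fbound \<xi> c \<Longrightarrow> fbound \<eta> d \<Longrightarrow> fbound (\<xi> + \<eta>) (c + d)"
  unfolding fbound_def
proof (intro allI impI)
  fix j and G :: "(nat \<times> 'a) set"
  assume x: "\<forall>j G. finite G \<longrightarrow> L2_set (\<lambda>(n, i). cmod (\<xi> n i j)) G \<le> c"
    and y: "\<forall>j G. finite G \<longrightarrow> L2_set (\<lambda>(n, i). cmod (\<eta> n i j)) G \<le> d" and G: "finite G"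
  have "L2_set (\<lambda>(n, i). cmod ((\<xi> + \<eta>) n i j)) G
      \<le> L2_set (\<lambda>x. (case x of (n, i) \<Rightarrow> cmod (\<xi> n i j)) + (case x of (n, i) \<Rightarrow> cmod (\<eta> n i j))) G"
    by (rule L2_set_mono) (auto simp: norm_triangle_ineq)
  also have "\<dots> \<le> L2_set (\<lambda>(n, i). cmod (\<xi> n i j)) G + L2_set (\<lambda>(n, i). cmod (\<eta> n i j)) G"
    by (rule L2_set_triangle_ineq)
  also have "\<dots> \<le> c + d" using x y G by (meson add_mono)
  finally show "L2_set (\<lambda>(n, i). cmod ((\<xi> + \<eta>) n i j)) G \<le> c + d" .
qed

lemma fbound_scale: "fbound \<xi> c \<Longrightarrow> fbound (fscale a \<xi>) (cmod a * c)"
  unfolding fbound_def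
proof (intro allI impI)
  fix j and G :: "(nat \<times> 'a) set"
  assume x: "\<forall>j G. finite G \<longrightarrow> L2_set (\<lambda>(n, i). cmod (\<xi> n i j)) G \<le> c" and G: "finite G"
  have "L2_set (\<lambda>(n, i). cmod (fscale a \<xi> n i j)) G
      = L2_set (\<lambda>x. cmod a * (case x of (n, i) \<Rightarrow> cmod (\<xi> n i j))) G"
    by (rule L2_set_cong) (auto simp: norm_mult)
  also have "\<dots> = cmod a * L2_set (\<lambda>(n, i). cmod (\<xi> n i j)) G"
    by (simp add: L2_set_right_distrib)
  also have "\<dots> \<le> cmod a * c" using x G by (simp add: mult_left_mono)
  finally show "L2_set (\<lambda>(n, i). cmod (fscale a \<xi> n i j)) G \<le> cmod a * c" .
qed

lemma fbound_0: "fbound 0 0"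
  by (simp add: fbound_def L2_set_def case_prod_unfold)

lemma fock_0 [simp]: "0 \<in> fock P"
  using fbound_0 by (auto simp: fock_iff)

lemma fock_add: "\<xi> \<in> fock P \<Longrightarrow> \<eta> \<in> fock P \<Longrightarrow> \<xi> + \<eta> \<in> fock P"
  using fbound_add by (fastforce simp: fock_iff)

lemma fock_scale: "\<xi> \<in> fock P \<Longrightarrow> fscale c \<xi> \<in> fock P"
  using fbound_scale by (fastforce simp: fock_iff)

lemma fock_diff:
  assumes "\<xi> \<in> fock P" "\<eta> \<in> fock P"
  shows "\<xi> - \<eta> \<in> fock P"
proof -
  have "\<xi> - \<eta> = \<xi> + fscale (-1) \<eta>" by (simp add: fun_eq_iff)
  then show ?thesis by (simp only: fock_add[OF assms(1) fock_scale[OF assms(2), of "-1"]])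
qed

lemma fnorm_0 [simp]: "fnorm 0 = 0"
  using fnorm_le[OF fbound_0] fnorm_nonneg by (metis order_antisym)

lemma fnorm_add: "\<xi> \<in> fock P \<Longrightarrow> \<eta> \<in> fock P \<Longrightarrow> fnorm (\<xi> + \<eta>) \<le> fnorm \<xi> + fnorm \<eta>"
  by (intro fnorm_le fbound_add fbound_fnorm)

lemma fnorm_scale:
  assumes "\<xi> \<in> fock P"
  shows "fnorm (fscale c \<xi>) = cmod c * fnorm \<xi>"
proof (rule antisym)
  show "fnorm (fscale c \<xi>) \<le> cmod c * fnorm \<xi>"
    using assms by (intro fnorm_le fbound_scale fbound_fnorm)
  show "cmod c * fnorm \<xi> \<le> fnorm (fscale c \<xi>)"
  proof (cases "c = 0")
    case False
    then have "\<xi> = fscale (inverse c) (fscale c \<xi>)" by (simp add: fun_eq_iff)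
    then have "fnorm \<xi> \<le> cmod (inverse c) * fnorm (fscale c \<xi>)"
      using assms by (metis fnorm_le fbound_scale fbound_fnorm fock_scale)
    then have "cmod c * fnorm \<xi> \<le> cmod c * (cmod (inverse c) * fnorm (fscale c \<xi>))"
      by (rule mult_left_mono) simp
    also have "\<dots> = fnorm (fscale c \<xi>)"
      using False by (simp add: norm_inverse)
    finally show ?thesis .
  qed simp
qed

lemma L2_set_le_fnorm:
  assumes "\<xi> \<in> fock P" "finite G"
  shows "L2_set (\<lambda>(n, i). cmod (\<xi> n i j)) G \<le> fnorm \<xi>"
  using fbound_fnorm[OF assms(1)] assms(2) by (auto simp: fbound_def)

lemma cmod_le_fnorm: "\<xi> \<in> fock P \<Longrightarrow> cmod (\<xi> n i j) \<le> fnorm \<xi>"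
  using L2_set_le_fnorm[of \<xi> P "{(n, i)}" j] by simp

lemma fock_eq_0: "mpow P n i j = 0 \<Longrightarrow> \<xi> \<in> fock P \<Longrightarrow> \<xi> n i j = 0"
  by (simp add: fock_iff)

section \<open>Bounded operators\<close>

definition oscale :: "complex \<Rightarrow> ('a fock_vec \<Rightarrow> 'a fock_vec) \<Rightarrow> 'a fock_vec \<Rightarrow> 'a fock_vec" where
  "oscale c T = (\<lambda>\<xi>. fscale c (T \<xi>))"

lemma oscale_apply [simp]: "oscale c T \<xi> = fscale c (T \<xi>)"
  by (simp add: oscale_def)

lemma bops_iff: "T \<in> bops P \<longleftrightarrow> (\<forall>\<xi>. \<xi> \<notin> fock P \<longrightarrow> T \<xi> = 0)
      \<and> (\<forall>\<xi>\<in>fock P. T \<xi> \<in> fock P)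
      \<and> (\<forall>\<xi>\<in>fock P. \<forall>\<eta>\<in>fock P. T (\<xi> + \<eta>) = T \<xi> + T \<eta>)
      \<and> (\<forall>\<xi>\<in>fock P. \<forall>c. T (fscale c \<xi>) = fscale c (T \<xi>))
      \<and> (\<exists>C. \<forall>\<xi>\<in>fock P. fnorm (T \<xi>) \<le> C * fnorm \<xi>)"
  by (simp add: bops_def fzero_eq_0 fscale_def plus_fun_def)

lemma bopsI:
  assumes "\<And>\<xi>. \<xi> \<notin> fock P \<Longrightarrow> T \<xi> = 0"
    and "\<And>\<xi>. \<xi> \<in> fock P \<Longrightarrow> T \<xi> \<in> fock P"
    and "\<And>\<xi> \<eta>. \<xi> \<in> fock P \<Longrightarrow> \<eta> \<in> fock P \<Longrightarrow> T (\<xi> + \<eta>) = T \<xi> + T \<eta>"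
    and "\<And>\<xi> c. \<xi> \<in> fock P \<Longrightarrow> T (fscale c \<xi>) = fscale c (T \<xi>)"
    and "\<And>\<xi>. \<xi> \<in> fock P \<Longrightarrow> fnorm (T \<xi>) \<le> C * fnorm \<xi>"
  shows "T \<in> bops P"
  using assms unfolding bops_iff by blast

lemma
  assumes "T \<in> bops P"
  shows bops_outside: "\<xi> \<notin> fock P \<Longrightarrow> T \<xi> = 0"
    and bops_fock_inside: "\<xi> \<in> fock P \<Longrightarrow> T \<xi> \<in> fock P"
    and bops_add: "\<xi> \<in> fock P \<Longrightarrow> \<eta> \<in> fock P \<Longrightarrow> T (\<xi> + \<eta>) = T \<xi> + T \<eta>"
    and bops_scale: "\<xi> \<in> fock P \<Longrightarrow> T (fscale c \<xi>) = fscale c (T \<xi>)"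
  using assms unfolding bops_iff by blast+

text \<open>Operators are normalised to 0 outside \<open>fock P\<close>, and 0 lies in
  \<open>fock P\<close>; hence no condition on \<open>\<xi>\<close>.\<close>

lemma bops_fock: "T \<in> bops P \<Longrightarrow> T \<xi> \<in> fock P"
  using bops_fock_inside bops_outside fock_0 by metis

lemma bops_app_0: "T \<in> bops P \<Longrightarrow> T 0 = 0"
proof -
  assume T: "T \<in> bops P"
  have "fscale 0 \<xi> = 0" for \<xi> :: "'a fock_vec" by (simp add: fun_eq_iff)
  then show ?thesis using bops_scale[OF T fock_0, of 0] by simp
qed

lemma bops_diff:
  assumes "T \<in> bops P" "\<xi> \<in> fock P" "\<eta> \<in> fock P"
  shows "T (\<xi> - \<eta>) = T \<xi> - T \<eta>"
proof -
  have "T \<xi> = T ((\<xi> - \<eta>) + \<eta>)" by simp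
  also have "\<dots> = T (\<xi> - \<eta>) + T \<eta>" using assms bops_add fock_diff by blast
  finally show ?thesis by simp
qed

text \<open>\<open>op_norm\<close> is a supremum in the reals, hence meaningful only for a set
  bounded above. The modulus of C appears because the constant in \<open>bops\<close> carries no
  sign.\<close>

lemma op_norm_set_bdd:
  assumes "T \<in> bops P"
  shows "bdd_above {fnorm (T \<xi>) | \<xi>. \<xi> \<in> fock P \<and> fnorm \<xi> \<le> 1}"
proof -
  obtain C where C: "\<forall>\<xi>\<in>fock P. fnorm (T \<xi>) \<le> C * fnorm \<xi>" using assms bops_iff by blast
  have "fnorm (T \<xi>) \<le> \<bar>C\<bar>" if "\<xi> \<in> fock P" "fnorm \<xi> \<le> 1" for \<xi>
  proof -
    have "fnorm (T \<xi>) \<le> C * fnorm \<xi>" using C that by blast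
    also have "\<dots> \<le> \<bar>C\<bar> * fnorm \<xi>" by (simp add: mult_right_mono)
    also have "\<dots> \<le> \<bar>C\<bar>" using that by (simp add: mult_left_le)
    finally show ?thesis .
  qed
  then show ?thesis by (auto simp: bdd_above_def)
qed

lemma op_norm_le:
  assumes "\<And>\<xi>. \<xi> \<in> fock P \<Longrightarrow> fnorm \<xi> \<le> 1 \<Longrightarrow> fnorm (T \<xi>) \<le> C"
  shows "op_norm P T \<le> C"
  unfolding op_norm_def
proof (rule cSup_least)
  show "{fnorm (T \<xi>) |\<xi>. \<xi> \<in> fock P \<and> fnorm \<xi> \<le> 1} \<noteq> {}"
    using fock_0[of P] fnorm_0 by (auto intro!: exI[of _ 0])
qed (use assms in auto)

lemma op_norm_nonneg:
  assumes "T \<in> bops P"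
  shows "0 \<le> op_norm P T"
proof -
  have "fnorm (T 0) \<le> op_norm P T"
    unfolding op_norm_def by (rule cSup_upper[OF _ op_norm_set_bdd[OF assms]]) (use fock_0[of P] in force)
  then show ?thesis using fnorm_nonneg order_trans by blast
qed

lemma fnorm_le_op_norm:
  assumes "T \<in> bops P" "\<xi> \<in> fock P"
  shows "fnorm (T \<xi>) \<le> op_norm P T * fnorm \<xi>"
proof -
  have 1: "fnorm (T \<eta>) \<le> op_norm P T" if "\<eta> \<in> fock P" "fnorm \<eta> \<le> 1" for \<eta>
    unfolding op_norm_def by (rule cSup_upper[OF _ op_norm_set_bdd[OF assms(1)]]) (use that in blast)
  show ?thesis
  proof (cases "fnorm \<xi> = 0")
    case True
    obtain C where C: "\<forall>\<xi>\<in>fock P. fnorm (T \<xi>) \<le> C * fnorm \<xi>" using assms bops_iff by blast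
    then show ?thesis using True assms(2) by fastforce
  next
    case False
    define \<eta> where "\<eta> = fscale (of_real (1 / fnorm \<xi>)) \<xi>"
    have eta: "\<eta> \<in> fock P" using assms(2) fock_scale \<eta>_def by blast
    have "fnorm \<eta> = 1"
      using False fnorm_scale[OF assms(2)] fnorm_nonneg[of \<xi>] by (simp add: \<eta>_def norm_divide)
    then have "fnorm (T \<eta>) \<le> op_norm P T" using 1 eta by simp
    moreover have "fnorm (T \<eta>) = fnorm (T \<xi>) / fnorm \<xi>"
      using bops_scale[OF assms] fnorm_scale[OF bops_fock[OF assms(1)]]
      by (simp add: \<eta>_def norm_divide)
    ultimately show ?thesis using False fnorm_nonneg[of \<xi>] by (simp add: divide_le_eq)
  qed
qed

lemma bops_add_op:
  assumes "S \<in> bops P" "T \<in> bops P"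
  shows "S + T \<in> bops P"
proof (rule bopsI[where C = "op_norm P S + op_norm P T"])
  fix \<xi> assume x: "\<xi> \<in> fock P"
  have "fnorm (S \<xi> + T \<xi>) \<le> fnorm (S \<xi>) + fnorm (T \<xi>)"
    using assms by (intro fnorm_add[where P = P] bops_fock)
  also have "\<dots> \<le> op_norm P S * fnorm \<xi> + op_norm P T * fnorm \<xi>"
    using assms x by (intro add_mono fnorm_le_op_norm)
  finally show "fnorm ((S + T) \<xi>) \<le> (op_norm P S + op_norm P T) * fnorm \<xi>"
    by (simp add: algebra_simps)
qed (simp_all add: bops_outside[OF assms(1)] bops_outside[OF assms(2)] fock_add bops_fock[OF assms(1)] bops_fock[OF assms(2)]
    bops_add[OF assms(1)] bops_add[OF assms(2)] bops_scale[OF assms(1)] bops_scale[OF assms(2)] fun_eq_iff algebra_simps)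

lemma bops_scale_op:
  assumes "T \<in> bops P"
  shows "oscale c T \<in> bops P"
proof (rule bopsI[where C = "cmod c * op_norm P T"])
  fix \<xi> assume x: "\<xi> \<in> fock P"
  show "fnorm (oscale c T \<xi>) \<le> cmod c * op_norm P T * fnorm \<xi>"
    using fnorm_scale[OF bops_fock[OF assms]] fnorm_le_op_norm[OF assms x]
    by (simp add: mult_left_mono mult.assoc)
qed (simp_all add: bops_outside[OF assms] fock_scale bops_fock[OF assms]
    bops_add[OF assms] bops_scale[OF assms] fun_eq_iff algebra_simps)

lemma bops_comp:
  assumes "S \<in> bops P" "T \<in> bops P"
  shows "S \<circ> T \<in> bops P"
proof (rule bopsI[where C = "op_norm P S * op_norm P T"])
  fix \<xi> assume x: "\<xi> \<in> fock P"
  have "fnorm (S (T \<xi>)) \<le> op_norm P S * fnorm (T \<xi>)"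
    using assms by (intro fnorm_le_op_norm bops_fock)
  also have "\<dots> \<le> op_norm P S * (op_norm P T * fnorm \<xi>)"
    using assms x by (intro mult_left_mono fnorm_le_op_norm op_norm_nonneg)
  finally show "fnorm ((S \<circ> T) \<xi>) \<le> op_norm P S * op_norm P T * fnorm \<xi>"
    by (simp add: algebra_simps)
qed (simp_all add: bops_outside[OF assms(2)] bops_app_0[OF assms(1)] bops_fock[OF assms(1)] bops_fock[OF assms(2)]
    bops_add[OF assms(1)] bops_add[OF assms(2)] bops_scale[OF assms(1)] bops_scale[OF assms(2)])

lemma bops_0: "0 \<in> bops P"
  by (rule bopsI[where C = 0]) (auto simp: fun_eq_iff)

lemma op_norm_add:
  assumes "S \<in> bops P" "T \<in> bops P"
  shows "op_norm P (S + T) \<le> op_norm P S + op_norm P T"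
proof (rule op_norm_le)
  fix \<xi> assume x: "\<xi> \<in> fock P" "fnorm \<xi> \<le> 1"
  have "fnorm (S \<xi> + T \<xi>) \<le> fnorm (S \<xi>) + fnorm (T \<xi>)"
    using assms by (intro fnorm_add[where P = P] bops_fock)
  also have "\<dots> \<le> op_norm P S * fnorm \<xi> + op_norm P T * fnorm \<xi>"
    using assms x by (intro add_mono fnorm_le_op_norm)
  also have "\<dots> \<le> op_norm P S + op_norm P T"
    using assms x by (intro add_mono mult_left_le op_norm_nonneg)
  finally show "fnorm ((S + T) \<xi>) \<le> op_norm P S + op_norm P T" by simp
qed

lemma op_norm_scale_le:
  assumes "T \<in> bops P"
  shows "op_norm P (oscale c T) \<le> cmod c * op_norm P T"
proof (rule op_norm_le)
  fix \<xi> assume x: "\<xi> \<in> fock P" "fnorm \<xi> \<le> 1"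
  have "fnorm (T \<xi>) \<le> op_norm P T"
    using fnorm_le_op_norm[OF assms x(1)] x mult_left_le op_norm_nonneg[OF assms] order_trans by blast
  then show "fnorm (oscale c T \<xi>) \<le> cmod c * op_norm P T"
    using fnorm_scale[OF bops_fock[OF assms]] by (simp add: mult_left_mono)
qed

lemma op_norm_comp:
  assumes "S \<in> bops P" "T \<in> bops P"
  shows "op_norm P (S \<circ> T) \<le> op_norm P S * op_norm P T"
proof (rule op_norm_le)
  fix \<xi> assume x: "\<xi> \<in> fock P" "fnorm \<xi> \<le> 1"
  have "fnorm (S (T \<xi>)) \<le> op_norm P S * fnorm (T \<xi>)"
    using assms by (intro fnorm_le_op_norm bops_fock)
  also have "\<dots> \<le> op_norm P S * (op_norm P T * fnorm \<xi>)"
    using assms x by (intro mult_left_mono fnorm_le_op_norm op_norm_nonneg)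
  also have "\<dots> \<le> op_norm P S * (op_norm P T * 1)"
    using assms x by (intro mult_left_mono op_norm_nonneg)
  finally show "fnorm ((S \<circ> T) \<xi>) \<le> op_norm P S * op_norm P T" by simp
qed

lemma op_norm_0 [simp]: "op_norm P 0 = 0"
proof (rule antisym)
  show "op_norm P 0 \<le> 0" by (rule op_norm_le) simp
  show "0 \<le> op_norm P 0" by (rule op_norm_nonneg[OF bops_0])
qed

lemma op_norm_eq_0D:
  assumes "T \<in> bops P" "op_norm P T \<le> 0"
  shows "T = 0"
proof (intro ext)
  fix \<xi> n i j
  show "T \<xi> n i j = 0 \<xi> n i j"
  proof (cases "\<xi> \<in> fock P")
    case True
    have "fnorm (T \<xi>) \<le> op_norm P T * fnorm \<xi>" using fnorm_le_op_norm[OF assms(1) True] .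
    also have "\<dots> \<le> 0" using assms(2) by (simp add: mult_nonpos_nonneg)
    finally have "fnorm (T \<xi>) \<le> 0" .
    moreover have "cmod (T \<xi> n i j) \<le> fnorm (T \<xi>)"
      by (rule cmod_le_fnorm[OF bops_fock[OF assms(1)]])
    ultimately have "cmod (T \<xi> n i j) \<le> 0" by linarith
    then show ?thesis by simp
  qed (simp add: bops_outside[OF assms(1)])
qed

lemma minus_eq_oscale: "S - T = S + oscale (-1) T"
  by (simp add: fun_eq_iff)

lemma bops_diff_op: "S \<in> bops P \<Longrightarrow> T \<in> bops P \<Longrightarrow> S - T \<in> bops P"
  by (simp add: minus_eq_oscale bops_add_op bops_scale_op)

lemma op_norm_diff:
  assumes "S \<in> bops P" "T \<in> bops P"
  shows "op_norm P (S - T) \<le> op_norm P S + op_norm P T"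
  using op_norm_add[OF assms(1) bops_scale_op[OF assms(2)], of "-1"] op_norm_scale_le[OF assms(2), of "-1"]
  by (simp add: minus_eq_oscale)

section \<open>The tensor algebra as a Banach algebra\<close>

lemma tensor_alg_iff:
  "T \<in> tensor_alg P \<longleftrightarrow> T \<in> bops P \<and> (\<forall>\<epsilon>>0. \<exists>S\<in>gen_alg P. S \<in> bops P \<and> op_norm P (T - S) < \<epsilon>)"
  by (simp add: tensor_alg_def fun_diff_def)

lemma tensor_alg_bops: "T \<in> tensor_alg P \<Longrightarrow> T \<in> bops P"
  by (simp add: tensor_alg_def)

lemma tensor_alg_gen: "T \<in> gen_alg P \<Longrightarrow> T \<in> bops P \<Longrightarrow> T \<in> tensor_alg P"
  unfolding tensor_alg_iff by (auto intro!: bexI[of _ T])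

lemma gen_alg_0: "0 \<in> gen_alg P"
proof -
  have "restr P (lmult (\<lambda>_. 0)) \<in> gen_alg P" by (rule gen_lmult) simp
  also have "restr P (lmult (\<lambda>_. 0)) = 0" by (simp add: fun_eq_iff restr_def fzero_def lmult_def)
  finally show ?thesis .
qed

lemma tensor_alg_0: "0 \<in> tensor_alg P"
  by (rule tensor_alg_gen[OF gen_alg_0 bops_0])

lemma gen_alg_add: "S \<in> gen_alg P \<Longrightarrow> T \<in> gen_alg P \<Longrightarrow> S + T \<in> gen_alg P"
  using gen_add[of S P T] by (simp add: plus_fun_def)

lemma gen_alg_scale: "S \<in> gen_alg P \<Longrightarrow> oscale c S \<in> gen_alg P"
  using gen_smult[of S P c] by (simp add: oscale_def fscale_def)

lemma tensor_alg_add: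
  assumes "S \<in> tensor_alg P" "T \<in> tensor_alg P"
  shows "S + T \<in> tensor_alg P"
  unfolding tensor_alg_iff
proof (intro conjI allI impI)
  show "S + T \<in> bops P" using assms by (simp add: bops_add_op tensor_alg_bops)
  fix \<epsilon> :: real assume "\<epsilon> > 0"
  then have e: "\<epsilon> / 2 > 0" by simp
  obtain S' where S': "S' \<in> gen_alg P" "S' \<in> bops P" "op_norm P (S - S') < \<epsilon> / 2"
    using e assms(1) tensor_alg_iff by blast
  obtain T' where T': "T' \<in> gen_alg P" "T' \<in> bops P" "op_norm P (T - T') < \<epsilon> / 2"
    using e assms(2) tensor_alg_iff by blast
  have "op_norm P ((S - S') + (T - T')) \<le> op_norm P (S - S') + op_norm P (T - T')"
    using assms S' T' by (auto intro!: op_norm_add bops_diff_op dest: tensor_alg_bops)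
  then have "op_norm P (S + T - (S' + T')) < \<epsilon>"
    using S'(3) T'(3) by (simp add: algebra_simps)
  then show "\<exists>R\<in>gen_alg P. R \<in> bops P \<and> op_norm P (S + T - R) < \<epsilon>"
    using S' T' gen_alg_add bops_add_op by blast
qed

lemma tensor_alg_scale:
  assumes "T \<in> tensor_alg P"
  shows "oscale c T \<in> tensor_alg P"
  unfolding tensor_alg_iff
proof (intro conjI allI impI)
  show "oscale c T \<in> bops P" using assms by (simp add: bops_scale_op tensor_alg_bops)
  fix \<epsilon> :: real assume e: "\<epsilon> > 0"
  obtain T' where T': "T' \<in> gen_alg P" "T' \<in> bops P" "op_norm P (T - T') < \<epsilon> / (cmod c + 1)"
    using e assms tensor_alg_iff by (metis add_nonneg_pos divide_pos_pos norm_ge_zero zero_less_one)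
  have "op_norm P (oscale c (T - T')) \<le> cmod c * op_norm P (T - T')"
    using assms T' by (auto intro!: op_norm_scale_le bops_diff_op dest: tensor_alg_bops)
  also have "\<dots> \<le> (cmod c + 1) * op_norm P (T - T')"
    using op_norm_nonneg[of "T - T'" P] assms T' by (simp add: bops_diff_op tensor_alg_bops distrib_right)
  also have "\<dots> < \<epsilon>"
    using T'(3) by (simp add: pos_less_divide_eq[of "cmod c + 1"] add_nonneg_pos mult.commute)
  finally have "op_norm P (oscale c T - oscale c T') < \<epsilon>"
    by (simp add: fun_eq_iff algebra_simps oscale_def fscale_def fun_diff_def)
  then show "\<exists>R\<in>gen_alg P. R \<in> bops P \<and> op_norm P (oscale c T - R) < \<epsilon>"
    using T' gen_alg_scale bops_scale_op by blast
qed

text \<open>Telescoping for the continuity of the product; additivity of \<open>S\<close> lets it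
  distribute over T - T'.\<close>

lemma comp_diff_eq:
  assumes "S \<in> bops P" "S' \<in> bops P" "T \<in> bops P" "T' \<in> bops P"
  shows "(S \<circ> T) - (S' \<circ> T') = (S \<circ> (T - T')) + ((S - S') \<circ> T')"
proof
  fix \<xi>
  show "((S \<circ> T) - (S' \<circ> T')) \<xi> = ((S \<circ> (T - T')) + ((S - S') \<circ> T')) \<xi>"
    using bops_diff[OF assms(1) bops_fock[OF assms(3), of \<xi>] bops_fock[OF assms(4), of \<xi>]] by simp
qed

lemma tensor_alg_comp:
  assumes "S \<in> tensor_alg P" "T \<in> tensor_alg P"
  shows "S \<circ> T \<in> tensor_alg P"
  unfolding tensor_alg_iff
proof (intro conjI allI impI)
  note SB = tensor_alg_bops[OF assms(1)] and TB = tensor_alg_bops[OF assms(2)]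
  show "S \<circ> T \<in> bops P" using SB TB by (rule bops_comp)
  fix \<epsilon> :: real assume e: "\<epsilon> > 0"
  \<comment> \<open>The added 1 makes \<open>s\<close>, and later \<open>t\<close>, positive
    divisors. \<open>T'\<close> is chosen before \<open>t\<close> because the bound on S - S' has to
    absorb the norm of \<open>T'\<close>.\<close>
  define s where "s = op_norm P S + 1"
  have s: "s > 0" using op_norm_nonneg[OF SB] by (simp add: s_def)
  obtain T' where T': "T' \<in> gen_alg P" "T' \<in> bops P" "op_norm P (T - T') < \<epsilon> / 2 / s"
    using e s assms(2) tensor_alg_iff by (metis divide_pos_pos zero_less_numeral)
  define t where "t = op_norm P T' + 1"
  have t: "t > 0" using op_norm_nonneg[OF T'(2)] by (simp add: t_def)
  obtain S' where S': "S' \<in> gen_alg P" "S' \<in> bops P" "op_norm P (S - S') < \<epsilon> / 2 / t"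
    using e t assms(1) tensor_alg_iff by (metis divide_pos_pos zero_less_numeral)
  have "op_norm P ((S \<circ> T) - (S' \<circ> T')) \<le> op_norm P (S \<circ> (T - T')) + op_norm P ((S - S') \<circ> T')"
    unfolding comp_diff_eq[OF SB S'(2) TB T'(2)]
    using SB TB S' T' by (intro op_norm_add bops_comp bops_diff_op)
  also have "\<dots> \<le> op_norm P S * op_norm P (T - T') + op_norm P (S - S') * op_norm P T'"
    using SB TB S' T' by (intro add_mono op_norm_comp bops_diff_op)
  also have "\<dots> \<le> s * op_norm P (T - T') + op_norm P (S - S') * t"
    using SB TB S' T' by (intro add_mono mult_mono order_refl op_norm_nonneg bops_diff_op)
        (use s t in \<open>auto simp: s_def t_def\<close>)
  also have "\<dots> < \<epsilon> / 2 + \<epsilon> / 2"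
    using S'(3) T'(3) s t by (intro add_strict_mono) (auto simp: field_simps)
  finally have "op_norm P ((S \<circ> T) - (S' \<circ> T')) < \<epsilon>" by simp
  then show "\<exists>R\<in>gen_alg P. R \<in> bops P \<and> op_norm P ((S \<circ> T) - R) < \<epsilon>"
    using S' T' gen_mult bops_comp by blast
qed

lemma tensor_alg_closed:
  assumes "T \<in> bops P" "\<And>\<epsilon>. \<epsilon> > 0 \<Longrightarrow> \<exists>S\<in>tensor_alg P. op_norm P (T - S) < \<epsilon>"
  shows "T \<in> tensor_alg P"
  unfolding tensor_alg_iff
proof (intro conjI allI impI)
  fix \<epsilon> :: real assume e: "\<epsilon> > 0"
  then obtain S where S: "S \<in> tensor_alg P" "op_norm P (T - S) < \<epsilon> / 2"
    using assms(2)[of "\<epsilon> / 2"] by auto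
  obtain R where R: "R \<in> gen_alg P" "R \<in> bops P" "op_norm P (S - R) < \<epsilon> / 2"
    using e S(1) by (metis half_gt_zero tensor_alg_iff)
  have "op_norm P ((T - S) + (S - R)) \<le> op_norm P (T - S) + op_norm P (S - R)"
    using assms(1) tensor_alg_bops[OF S(1)] R(2) by (intro op_norm_add bops_diff_op)
  then have "op_norm P (T - R) < \<epsilon>" using S(2) R(3) by simp
  then show "\<exists>R\<in>gen_alg P. R \<in> bops P \<and> op_norm P (T - R) < \<epsilon>" using R by blast
qed (rule assms(1))

section \<open>Norm-convergent series of operators\<close>

lemma sum_apply: "(\<Sum>a\<in>A. f a) x = (\<Sum>a\<in>A. f a x)"
  by (induction A rule: infinite_finite_induct) auto

lemma bops_sum: "(\<And>k. k \<in> A \<Longrightarrow> u k \<in> bops P) \<Longrightarrow> sum u A \<in> bops P"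
  by (induction A rule: infinite_finite_induct) (auto simp: bops_0 bops_add_op)

lemma tensor_alg_sum: "(\<And>k. k \<in> A \<Longrightarrow> u k \<in> tensor_alg P) \<Longrightarrow> sum u A \<in> tensor_alg P"
  by (induction A rule: infinite_finite_induct) (auto simp: tensor_alg_0 tensor_alg_add)

lemma tensor_alg_diff: "S \<in> tensor_alg P \<Longrightarrow> T \<in> tensor_alg P \<Longrightarrow> S - T \<in> tensor_alg P"
  by (simp add: minus_eq_oscale tensor_alg_add tensor_alg_scale)

lemma op_norm_geometric_block:
  assumes u: "\<And>k. u k \<in> bops P" "\<And>k. op_norm P (u k) \<le> (1/4)^k"
  shows "op_norm P (sum u {..<N + M} - sum u {..<N}) \<le> 4/3 * (1/4)^N"
proof -
  \<comment> \<open>The exact geometric sum of the exponents from N to N + M - 1; the subtracted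
    term makes the induction go through.\<close>
  have "op_norm P (sum u {..<N + M} - sum u {..<N}) \<le> 4/3 * (1/4)^N - 4/3 * (1/4)^(N + M)"
  proof (induction M)
    case (Suc M)
    have "op_norm P ((sum u {..<N + M} - sum u {..<N}) + u (N + M))
        \<le> op_norm P (sum u {..<N + M} - sum u {..<N}) + op_norm P (u (N + M))"
      using u by (intro op_norm_add bops_diff_op bops_sum) auto
    also have "\<dots> \<le> 4/3 * (1/4)^N - 4/3 * (1/4)^(N + M) + (1/4)^(N + M)"
      using Suc.IH u(2)[of "N + M"] by linarith
    finally have "op_norm P ((sum u {..<N + M} - sum u {..<N}) + u (N + M)) \<le> 4/3 * (1/4)^N - 4/3 * (1/4)^(N + Suc M)"
      by simp
    moreover have "(sum u {..<N + M} - sum u {..<N}) + u (N + M) = sum u {..<N + Suc M} - sum u {..<N}"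
      by simp
    ultimately show ?case by metis
  next
    case 0
    show ?case by (simp only: add_0_right diff_self op_norm_0)
  qed
  moreover have "(0::real) \<le> 4/3 * (1/4)^(N + M)" by simp
  ultimately show ?thesis by linarith
qed

text \<open>Completeness of the bounded operators in the quantitative form used below. The sum is
  taken coordinate by coordinate, and the bounds on finite index sets survive the limit.\<close>

lemma bops_series:
  assumes u: "\<And>k. u k \<in> bops P" "\<And>k. op_norm P (u k) \<le> (1/4)^k"
  obtains x where "x \<in> bops P" "\<And>N. op_norm P (x - sum u {..<N}) \<le> 4/3 * (1/4)^N"
proof
  define s where "s N = sum u {..<N}" for N
  define x where "x = (\<lambda>\<xi> n i j. \<Sum>k. u k \<xi> n i j)"
  have s_bops: "s N \<in> bops P" for N
    unfolding s_def using u by (intro bops_sum) auto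
  have s_apply: "s N \<xi> n i j = (\<Sum>k<N. u k \<xi> n i j)" for N \<xi> n i j
    by (simp add: s_def sum_apply)
  have summ: "summable (\<lambda>k. u k \<xi> n i j)" if "\<xi> \<in> fock P" for \<xi> n i j
  proof (rule summable_comparison_test')
    show "summable (\<lambda>k. (1/4)^k * fnorm \<xi>)" by (intro summable_mult2 summable_geometric) simp
    fix k
    have "cmod (u k \<xi> n i j) \<le> fnorm (u k \<xi>)"
      by (rule cmod_le_fnorm[OF bops_fock[OF u(1)]])
    also have "\<dots> \<le> op_norm P (u k) * fnorm \<xi>" by (rule fnorm_le_op_norm[OF u(1) that])
    also have "\<dots> \<le> (1/4)^k * fnorm \<xi>" by (rule mult_right_mono[OF u(2)]) simp
    finally show "norm (u k \<xi> n i j) \<le> (1/4)^k * fnorm \<xi>" by simp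
  qed
  have lim: "(\<lambda>M. s (N + M) \<xi> n i j) \<longlonglongrightarrow> x \<xi> n i j" if "\<xi> \<in> fock P" for N \<xi> n i j
  proof -
    have "(\<lambda>M. s M \<xi> n i j) \<longlonglongrightarrow> x \<xi> n i j"
      unfolding s_apply x_def by (rule summable_LIMSEQ[OF summ[OF that]])
    from LIMSEQ_ignore_initial_segment[OF this, of N] show ?thesis by (simp add: add.commute)
  qed
  have bound: "fbound (x \<xi> - s N \<xi>) (4/3 * (1/4)^N * fnorm \<xi>)" if x: "\<xi> \<in> fock P" for \<xi> N
    unfolding fbound_def
  proof (intro allI impI)
    fix j and G :: "(nat \<times> 'a) set" assume G: "finite G"
    have "(\<lambda>M. L2_set (\<lambda>(n, i). cmod ((s (N + M) - s N) \<xi> n i j)) G)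
        \<longlonglongrightarrow> L2_set (\<lambda>(n, i). cmod ((x \<xi> - s N \<xi>) n i j)) G"
      unfolding L2_set_def case_prod_unfold using lim[OF x]
      by (auto intro!: tendsto_intros)
    moreover have "L2_set (\<lambda>(n, i). cmod ((s (N + M) - s N) \<xi> n i j)) G \<le> 4/3 * (1/4)^N * fnorm \<xi>" for M
    proof -
      have b: "s (N + M) - s N \<in> bops P" by (intro bops_diff_op s_bops)
      have "L2_set (\<lambda>(n, i). cmod ((s (N + M) - s N) \<xi> n i j)) G \<le> fnorm ((s (N + M) - s N) \<xi>)"
        by (rule L2_set_le_fnorm[OF bops_fock[OF b] G])
      also have "\<dots> \<le> op_norm P (s (N + M) - s N) * fnorm \<xi>"
        by (rule fnorm_le_op_norm[OF b x])
      also have "\<dots> \<le> 4/3 * (1/4)^N * fnorm \<xi>"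
        unfolding s_def by (intro mult_right_mono op_norm_geometric_block u) simp
      finally show ?thesis .
    qed
    ultimately show "L2_set (\<lambda>(n, i). cmod ((x \<xi> - s N \<xi>) n i j)) G \<le> 4/3 * (1/4)^N * fnorm \<xi>"
      using LIMSEQ_le_const2 by blast
  qed
  have s0: "s 0 = 0" by (simp add: s_def)
  have u_0: "u k \<xi> n i j = 0" if "mpow P n i j = 0" for k \<xi> n i j
    by (rule fock_eq_0[OF that bops_fock[OF u(1)]])
  have x_fock: "x \<xi> \<in> fock P" if "\<xi> \<in> fock P" for \<xi>
    unfolding fock_iff using bound[OF that, of 0] u_0 by (auto simp: s0 x_def)
  show xb: "x \<in> bops P"
  proof (rule bopsI[where C = "4/3"])
    fix \<xi> assume "\<xi> \<notin> fock P"
    then show "x \<xi> = 0" by (simp add: x_def fun_eq_iff bops_outside[OF u(1)])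
  next
    fix \<xi> \<eta> assume "\<xi> \<in> fock P" "\<eta> \<in> fock P"
    then show "x (\<xi> + \<eta>) = x \<xi> + x \<eta>"
      by (simp add: x_def fun_eq_iff bops_add[OF u(1)] suminf_add[OF summ summ])
  next
    fix \<xi> c assume "\<xi> \<in> fock P"
    then show "x (fscale c \<xi>) = fscale c (x \<xi>)"
      by (simp add: x_def fun_eq_iff bops_scale[OF u(1)] suminf_mult[OF summ])
  next
    fix \<xi> assume "\<xi> \<in> fock P"
    from fnorm_le[OF bound[OF this, of 0]] show "fnorm (x \<xi>) \<le> 4/3 * fnorm \<xi>" by (simp add: s0)
  qed (rule x_fock)
  fix N
  show "op_norm P (x - sum u {..<N}) \<le> 4/3 * (1/4)^N"
  proof (rule op_norm_le)
    fix \<xi> assume x: "\<xi> \<in> fock P" "fnorm \<xi> \<le> 1"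
    have "fnorm ((x - s N) \<xi>) \<le> 4/3 * (1/4)^N * fnorm \<xi>" using fnorm_le[OF bound[OF x(1), of N]] by simp
    also have "\<dots> \<le> 4/3 * (1/4)^N" using x(2) by (intro mult_left_le) auto
    finally show "fnorm ((x - sum u {..<N}) \<xi>) \<le> 4/3 * (1/4)^N" by (simp add: s_def)
  qed
qed

lemma geometric_quarter_small: "\<epsilon> > 0 \<Longrightarrow> \<exists>N. C * (1/4)^N < (\<epsilon>::real)"
proof -
  assume "\<epsilon> > 0"
  have "(\<lambda>N. C * (1/4)^N) \<longlonglongrightarrow> C * (0::real)"
    by (intro tendsto_intros LIMSEQ_realpow_zero) auto
  then have "\<forall>\<^sub>F N in sequentially. C * (1/4)^N < \<epsilon>"
    using \<open>\<epsilon> > 0\<close> by (intro order_tendstoD(2)) auto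
  then show ?thesis by (auto simp: eventually_sequentially)
qed

lemma tensor_alg_series:
  assumes u: "\<And>k. u k \<in> tensor_alg P" "\<And>k. op_norm P (u k) \<le> (1/4)^k"
  obtains x where "x \<in> tensor_alg P" "\<And>N. op_norm P (x - sum u {..<N}) \<le> 4/3 * (1/4)^N"
proof -
  obtain x where x: "x \<in> bops P" "\<And>N. op_norm P (x - sum u {..<N}) \<le> 4/3 * (1/4)^N"
    using bops_series[OF tensor_alg_bops[OF u(1)] u(2)] by blast
  have "x \<in> tensor_alg P"
  proof (rule tensor_alg_closed[OF x(1)])
    fix \<epsilon> :: real assume "\<epsilon> > 0"
    then obtain N where "4/3 * (1/4)^N < \<epsilon>" using geometric_quarter_small by blast
    with x(2)[of N] have "op_norm P (x - sum u {..<N}) < \<epsilon>" by linarith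
    moreover have "sum u {..<N} \<in> tensor_alg P" using u(1) by (intro tensor_alg_sum)
    ultimately show "\<exists>S\<in>tensor_alg P. op_norm P (x - S) < \<epsilon>" by blast
  qed
  with x(2) show ?thesis by (rule that[rotated])
qed

section \<open>Gliding humps\<close>

text \<open>The common skeleton of the three constructions below. The n-th term is chosen after the
  earlier ones, so \<open>pick\<close> has to succeed against every partial sum y.
  \<open>C n\<close> is the loss that later terms may cause at the n-th functional, and
  \<open>limit\<close> is the only place where an infinite sum enters.\<close>

lemma gliding_hump:
  fixes g :: "nat \<Rightarrow> 'x::comm_monoid_add \<Rightarrow> real" and M :: "nat \<Rightarrow> 'y \<Rightarrow> 'x"
  assumes zero: "0 \<in> X" and step: "\<And>n y a. y \<in> X \<Longrightarrow> a \<in> D n \<Longrightarrow> y + M n a \<in> X"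
    and pick: "\<And>n y. y \<in> X \<Longrightarrow> \<exists>a\<in>D n. c n \<le> g n (y + M n a)"
    and limit: "\<And>a. (\<And>n. a n \<in> D n) \<Longrightarrow> \<exists>x\<in>X. \<forall>n. g n (\<Sum>k\<le>n. M k (a k)) - C n \<le> g n x"
  shows "\<exists>x\<in>X. \<forall>n. c n - C n \<le> g n x"
proof -
  have "\<forall>n y. \<exists>a. y \<in> X \<longrightarrow> a \<in> D n \<and> c n \<le> g n (y + M n a)" using pick by blast
  then obtain p where p: "\<And>n y. y \<in> X \<Longrightarrow> p n y \<in> D n \<and> c n \<le> g n (y + M n (p n y))" by metis
  \<comment> \<open>Recursion on the partial sums turns the dependent choices into a function: the
    n-th choice is \<open>p n (s n)\<close>.\<close>
  define s where "s = rec_nat 0 (\<lambda>n y. y + M n (p n y))"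
  define a where "a n = p n (s n)" for n
  have s_Suc: "s (Suc n) = s n + M n (a n)" for n by (simp add: s_def a_def)
  have s: "s n \<in> X" for n
    by (induction n) (use zero step p in \<open>auto simp: s_def\<close>)
  have s_sum: "s (Suc n) = (\<Sum>k\<le>n. M k (a k))" for n
  proof (induction n)
    case 0
    show ?case by (simp add: s_Suc) (simp add: s_def)
  next
    case (Suc n)
    then show ?case by (simp add: s_Suc[of "Suc n"])
  qed
  have "a n \<in> D n" for n using p s by (simp add: a_def)
  then obtain x where x: "x \<in> X" "\<forall>n. g n (\<Sum>k\<le>n. M k (a k)) - C n \<le> g n x"
    using limit by blast
  have "c n - C n \<le> g n x" for n
  proof -
    have "c n \<le> g n (s (Suc n))" using p[OF s[of n], of n] by (simp add: s_Suc a_def)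
    then show ?thesis using x(2) by (metis s_sum diff_right_mono order_trans)
  qed
  with x(1) show ?thesis by blast
qed

section \<open>Powers of a stochastic matrix\<close>

text \<open>Tonelli for nonnegative families. It yields both the row sums of the powers and the
  associativity behind \<open>mpow_add\<close>.\<close>

lemma has_sum_swap_nonneg:
  fixes f :: "'b \<Rightarrow> 'c \<Rightarrow> real"
  assumes "\<And>x y. 0 \<le> f x y" and "\<And>x. (f x has_sum g x) UNIV" and "(g has_sum S) UNIV"
    and "\<And>y. ((\<lambda>x. f x y) has_sum h y) UNIV"
  shows "(h has_sum S) UNIV"
proof -
  have 1: "(\<lambda>(x, y). f x y) summable_on (UNIV \<times> UNIV)"
    using assms by (intro summable_on_SigmaI[where g = g]) (auto simp: summable_on_def)
  have "((\<lambda>(x, y). f x y) has_sum S) (UNIV \<times> UNIV)"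
    using assms by (intro has_sum_SigmaI[where g = g] 1) auto
  then have "((\<lambda>(y, x). f x y) has_sum S) (UNIV \<times> UNIV)"
    by (subst has_sum_swap) simp
  then show ?thesis
    by (rule has_sum_SigmaD) (use assms in auto)
qed

context
  fixes P :: "'a \<Rightarrow> 'a \<Rightarrow> real"
  assumes P: "stochastic P"
begin

lemma stochastic_le_1: "P i j \<le> 1"
  using finite_sum_le_has_sum[where f = "P i" and S = 1 and A = UNIV and B = "{j}"] P
  by (auto simp: stochastic_def)

lemma mpow_nonneg: "0 \<le> mpow P n i j"
  by (induction n arbitrary: j) (use P in \<open>auto simp: stochastic_def intro!: infsum_nonneg mult_nonneg_nonneg\<close>)

text \<open>A divergent \<open>infsum\<close> would be 0, so the recursion of \<open>mpow\<close>
  has its intended meaning only with summability. That follows from the row sum of the preceding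
  power, which stays an assumption until \<open>mpow_row\<close> is proved by induction.\<close>

lemma mpow_Suc_has_sum_aux:
  assumes "(mpow P n i has_sum 1) UNIV"
  shows "((\<lambda>j. mpow P n i j * P j k) has_sum mpow P (Suc n) i k) UNIV"
proof -
  have "(\<lambda>j. mpow P n i j * P j k) summable_on UNIV"
  proof (rule summable_on_comparison_test)
    show "mpow P n i summable_on UNIV" using assms by (auto simp: summable_on_def)
    fix j
    show "mpow P n i j * P j k \<le> mpow P n i j"
      by (rule mult_left_le[OF stochastic_le_1 mpow_nonneg])
    show "0 \<le> mpow P n i j * P j k" using P mpow_nonneg by (simp add: stochastic_def)
  qed
  then show ?thesis by (simp add: has_sum_infsum)
qed

lemma mpow_row: "(mpow P n i has_sum 1) UNIV"
proof (induction n)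
  case 0
  show ?case by (rule has_sum_finite_neutralI[of "{i}"]) auto
next
  case (Suc n)
  show ?case
  proof (rule has_sum_swap_nonneg)
    show "((\<lambda>k. mpow P n i j * P j k) has_sum mpow P n i j) UNIV" for j
      using has_sum_cmult_right[where f = "P j" and c = "mpow P n i j" and A = UNIV and a = 1] P by (simp add: stochastic_def)
    show "0 \<le> mpow P n i j * P j k" for j k using P mpow_nonneg by (simp add: stochastic_def)
    show "((\<lambda>j. mpow P n i j * P j k) has_sum mpow P (Suc n) i k) UNIV" for k
      by (rule mpow_Suc_has_sum_aux[OF Suc])
  qed (rule Suc)
qed

lemmas mpow_Suc_has_sum = mpow_Suc_has_sum_aux[OF mpow_row]

lemma mpow_add: "((\<lambda>j. mpow P n i j * mpow P m j k) has_sum mpow P (n + m) i k) UNIV"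
proof (induction m arbitrary: k)
  case 0
  show ?case by (rule has_sum_finite_neutralI[of "{k}"]) auto
next
  case (Suc m)
  show ?case
  proof (rule has_sum_swap_nonneg)
    show "0 \<le> mpow P n i j * (mpow P m j l * P l k)" for j l
      using P mpow_nonneg by (simp add: stochastic_def)
    show "((\<lambda>j. mpow P n i j * (mpow P m j l * P l k)) has_sum (mpow P (n + m) i l * P l k)) UNIV" for l
      using has_sum_cmult_left[OF Suc[of l], where c = "P l k"] by (simp add: mult.assoc)
    show "((\<lambda>l. mpow P (n + m) i l * P l k) has_sum mpow P (n + Suc m) i k) UNIV"
      using mpow_Suc_has_sum[of "n + m"] by simp
    show "((\<lambda>l. mpow P n i j * (mpow P m j l * P l k)) has_sum (mpow P n i j * mpow P (Suc m) j k)) UNIV" for j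
      by (rule has_sum_cmult_right[OF mpow_Suc_has_sum])
  qed
qed

lemma sum_mpow_le: "finite J \<Longrightarrow> (\<Sum>j\<in>J. mpow P n i j * mpow P m j k) \<le> mpow P (n + m) i k"
  by (rule finite_sum_le_has_sum[OF mpow_add]) (auto simp: mpow_nonneg)

text \<open>One intermediate state in the Chapman-Kolmogorov sum. This bounds the weights of
  \<open>rcreate\<close> by 1 and makes positivity multiplicative along paths.\<close>

lemma mpow_mult_le: "mpow P n i j * mpow P m j k \<le> mpow P (n + m) i k"
  using sum_mpow_le[of "{j}"] by simp

end

section \<open>Shifts are bounded\<close>

lemma fbound_sqI:
  assumes "0 \<le> c" "\<And>j G. finite G \<Longrightarrow> (\<Sum>(n, i)\<in>G. (cmod (\<xi> n i j))\<^sup>2) \<le> c\<^sup>2"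
  shows "fbound \<xi> c"
  unfolding fbound_def L2_set_def case_prod_unfold
  using assms by (auto intro!: real_le_lsqrt sum_nonneg simp: case_prod_unfold)

lemma sum_sq_le_fnorm:
  assumes "\<xi> \<in> fock P" "finite G"
  shows "(\<Sum>(n, i)\<in>G. (cmod (\<xi> n i j))\<^sup>2) \<le> (fnorm \<xi>)\<^sup>2"
proof -
  have "(\<Sum>(n, i)\<in>G. (cmod (\<xi> n i j))\<^sup>2) = (L2_set (\<lambda>(n, i). cmod (\<xi> n i j)) G)\<^sup>2"
    by (simp add: L2_set_def case_prod_unfold sum_nonneg)
  also have "\<dots> \<le> (fnorm \<xi>)\<^sup>2" by (intro power_mono L2_set_le_fnorm[OF assms]) simp
  finally show ?thesis .
qed

lemma shifted_sum_sq_le_fnorm: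
  assumes "\<xi> \<in> fock P" "finite G"
  shows "(\<Sum>(d, i)\<in>G. if p \<le> d then (cmod (\<xi> (d - p) i j))\<^sup>2 else 0) \<le> (fnorm \<xi>)\<^sup>2"
proof -
  let ?G = "{x \<in> G. p \<le> fst x}" and ?h = "\<lambda>x :: nat \<times> 'a. (fst x - p, snd x)"
  have "(\<Sum>(d, i)\<in>G. if p \<le> d then (cmod (\<xi> (d - p) i j))\<^sup>2 else 0)
      = (\<Sum>x\<in>?G. (cmod (\<xi> (fst x - p) (snd x) j))\<^sup>2)"
    unfolding case_prod_unfold by (simp add: sum.inter_filter[OF assms(2)])
  also have "\<dots> = (\<Sum>(n, i)\<in>?h ` ?G. (cmod (\<xi> n i j))\<^sup>2)"
    by (subst sum.reindex) (auto simp: inj_on_def prod_eq_iff)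
  also have "\<dots> \<le> (fnorm \<xi>)\<^sup>2" using assms by (intro sum_sq_le_fnorm) auto
  finally show ?thesis .
qed

lemma arv_iff: "A \<in> arv P n \<longleftrightarrow> (\<forall>i j. mpow P n i j = 0 \<longrightarrow> A i j = 0)
    \<and> (\<exists>\<alpha>. \<forall>j I. finite I \<longrightarrow> (\<Sum>i\<in>I. (cmod (A i j))\<^sup>2) \<le> \<alpha>)"
proof -
  have *: "colbound A \<le> ennreal \<alpha> \<longleftrightarrow> (\<forall>j I. finite I \<longrightarrow> (\<Sum>i\<in>I. (cmod (A i j))\<^sup>2) \<le> \<alpha>)" if "0 \<le> \<alpha>" for \<alpha>
  proof -
    have "infsum (\<lambda>i. ennreal ((cmod (A i j))\<^sup>2)) UNIV
        = (SUP F\<in>{F. finite F \<and> F \<subseteq> UNIV}. ennreal (\<Sum>i\<in>F. (cmod (A i j))\<^sup>2))" for j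
      by (subst nonneg_infsum_complete) auto
    then show ?thesis using that by (auto simp: colbound_def SUP_le_iff ennreal_le_iff)
  qed
  have "colbound A < \<infinity> \<longleftrightarrow> (\<exists>\<alpha>. \<forall>j I. finite I \<longrightarrow> (\<Sum>i\<in>I. (cmod (A i j))\<^sup>2) \<le> \<alpha>)"
  proof
    assume "colbound A < \<infinity>"
    then have "colbound A = ennreal (enn2real (colbound A))" by simp
    then show "\<exists>\<alpha>. \<forall>j I. finite I \<longrightarrow> (\<Sum>i\<in>I. (cmod (A i j))\<^sup>2) \<le> \<alpha>"
      using *[of "enn2real (colbound A)"] by auto
  next
    assume "\<exists>\<alpha>. \<forall>j I. finite I \<longrightarrow> (\<Sum>i\<in>I. (cmod (A i j))\<^sup>2) \<le> \<alpha>"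
    then obtain \<alpha> where a: "\<And>j I. finite I \<Longrightarrow> (\<Sum>i\<in>I. (cmod (A i j))\<^sup>2) \<le> \<alpha>" by blast
    have "0 \<le> \<alpha>" using a[of "{}"] by simp
    then have "colbound A \<le> ennreal \<alpha>" using * a by blast
    then show "colbound A < \<infinity>"
      using ennreal_less_top infinity_ennreal_def order_le_less_trans by metis
  qed
  then show ?thesis by (simp add: arv_def)
qed

lemma lmult_bops:
  assumes "bdd_above (range (\<lambda>i. cmod (a i)))"
  shows "restr P (lmult a) \<in> bops P"
proof -
  obtain C where C: "\<And>i. cmod (a i) \<le> C" using assms by (auto simp: bdd_above_def)
  have C0: "0 \<le> C" using C norm_ge_zero order_trans by blast
  have bound: "fbound (lmult a \<xi>) (C * fnorm \<xi>)" if x: "\<xi> \<in> fock P" for \<xi>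
    unfolding fbound_def
  proof (intro allI impI)
    fix j and G :: "(nat \<times> 'a) set" assume G: "finite G"
    have "L2_set (\<lambda>(n, i). cmod (lmult a \<xi> n i j)) G
        \<le> L2_set (\<lambda>x. C * (case x of (n, i) \<Rightarrow> cmod (\<xi> n i j))) G"
      by (rule L2_set_mono) (auto simp: lmult_def norm_mult C mult_right_mono)
    also have "\<dots> = C * L2_set (\<lambda>(n, i). cmod (\<xi> n i j)) G"
      by (simp add: L2_set_right_distrib C0)
    also have "\<dots> \<le> C * fnorm \<xi>" by (intro mult_left_mono L2_set_le_fnorm[OF x G] C0)
    finally show "L2_set (\<lambda>(n, i). cmod (lmult a \<xi> n i j)) G \<le> C * fnorm \<xi>" .
  qed
  show ?thesis
  proof (rule bopsI[where C = C])
    fix \<xi> assume x: "\<xi> \<in> fock P"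
    show "restr P (lmult a) \<xi> \<in> fock P"
      using x bound[OF x] by (auto simp: restr_def fock_iff lmult_def)
    show "fnorm (restr P (lmult a) \<xi>) \<le> C * fnorm \<xi>"
      using x fnorm_le[OF bound[OF x]] by (simp add: restr_def)
    show "restr P (lmult a) (fscale c \<xi>) = fscale c (restr P (lmult a) \<xi>)" for c
      using x fock_scale[OF x] by (simp add: restr_def lmult_def fun_eq_iff)
    show "restr P (lmult a) (\<xi> + \<eta>) = restr P (lmult a) \<xi> + restr P (lmult a) \<eta>" if "\<eta> \<in> fock P" for \<eta>
      using x that fock_add[OF x that] by (simp add: restr_def lmult_def fun_eq_iff algebra_simps)
  qed (simp add: restr_def fzero_eq_0)
qed

context
  fixes P :: "'a \<Rightarrow> 'a \<Rightarrow> real"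
  assumes P: "stochastic P"
begin

abbreviation (input) uterm where
  "uterm n A m B i k j \<equiv> complex_of_real (sqrt (mpow P n i j)) * A i j
      * (complex_of_real (sqrt (mpow P m j k)) * B j k)"

text \<open>By Chapman-Kolmogorov the first Cauchy-Schwarz factor is at most the square root of
  \<open>mpow P (n + m) i k\<close>, which is exactly the denominator in \<open>Umap\<close>. What
  remains is an unweighted sum, controlled by column bounds.\<close>

lemma uterm_Cauchy_Schwarz:
  assumes "finite J"
  shows "(\<Sum>j\<in>J. cmod (uterm n A m B i k j))
    \<le> sqrt (mpow P (n + m) i k) * sqrt (\<Sum>j\<in>J. (cmod (A i j))\<^sup>2 * (cmod (B j k))\<^sup>2)"
proof -
  note nn = mpow_nonneg[OF P]
  have "(\<Sum>j\<in>J. cmod (uterm n A m B i k j))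
      = (\<Sum>j\<in>J. \<bar>sqrt (mpow P n i j * mpow P m j k)\<bar> * \<bar>cmod (A i j) * cmod (B j k)\<bar>)"
    by (intro sum.cong) (auto simp: norm_mult real_sqrt_mult nn)
  also have "\<dots> \<le> L2_set (\<lambda>j. sqrt (mpow P n i j * mpow P m j k)) J * L2_set (\<lambda>j. cmod (A i j) * cmod (B j k)) J"
    by (rule L2_set_mult_ineq)
  also have "\<dots> = sqrt (\<Sum>j\<in>J. mpow P n i j * mpow P m j k) * sqrt (\<Sum>j\<in>J. (cmod (A i j))\<^sup>2 * (cmod (B j k))\<^sup>2)"
    by (simp add: L2_set_def nn power_mult_distrib)
  also have "\<dots> \<le> sqrt (mpow P (n + m) i k) * sqrt (\<Sum>j\<in>J. (cmod (A i j))\<^sup>2 * (cmod (B j k))\<^sup>2)"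
    using sum_mpow_le[OF P assms] by (intro mult_right_mono) (auto intro: sum_nonneg)
  finally show ?thesis .
qed

lemma uterm_summable:
  assumes A: "A \<in> arv P n" and x: "\<xi> \<in> fock P"
  shows "uterm n A m (\<xi> m) i k summable_on UNIV"
proof -
  obtain \<alpha> where a: "\<And>j I. finite I \<Longrightarrow> (\<Sum>i\<in>I. (cmod (A i j))\<^sup>2) \<le> \<alpha>"
    using A by (auto simp: arv_iff)
  have a1: "(cmod (A i j))\<^sup>2 \<le> \<alpha>" for j using a[of "{i}" j] by simp
  have a0: "0 \<le> \<alpha>" using a[of "{}"] by simp
  have "(\<Sum>j\<in>J. cmod (uterm n A m (\<xi> m) i k j)) \<le> sqrt (mpow P (n + m) i k) * sqrt (\<alpha> * (fnorm \<xi>)\<^sup>2)"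
    if J: "finite J" for J
  proof -
    have "(\<Sum>j\<in>J. (cmod (A i j))\<^sup>2 * (cmod (\<xi> m j k))\<^sup>2) \<le> (\<Sum>j\<in>J. \<alpha> * (cmod (\<xi> m j k))\<^sup>2)"
      by (intro sum_mono mult_right_mono a1) simp
    also have "\<dots> = \<alpha> * (\<Sum>(n, i)\<in>{m} \<times> J. (cmod (\<xi> n i k))\<^sup>2)"
      by (simp add: sum_distrib_left flip: sum.cartesian_product)
    also have "\<dots> \<le> \<alpha> * (fnorm \<xi>)\<^sup>2"
      using J by (intro mult_left_mono sum_sq_le_fnorm[OF x] a0) auto
    finally have "sqrt (\<Sum>j\<in>J. (cmod (A i j))\<^sup>2 * (cmod (\<xi> m j k))\<^sup>2) \<le> sqrt (\<alpha> * (fnorm \<xi>)\<^sup>2)"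
      by simp
    with uterm_Cauchy_Schwarz[OF J, where n = n and A = A and m = m and B = "\<xi> m" and i = i and k = k] show ?thesis
      by (meson mult_left_mono order_trans real_sqrt_ge_zero mpow_nonneg[OF P])
  qed
  then have "(\<lambda>j. norm (uterm n A m (\<xi> m) i k j)) summable_on UNIV"
    by (intro nonneg_bdd_above_summable_on) (auto simp: bdd_above_def)
  then show ?thesis by (rule abs_summable_summable)
qed

lemma shift_fbound:
  assumes A: "A \<in> arv P n"
  obtains C where "\<And>\<xi>. \<xi> \<in> fock P \<Longrightarrow> fbound (shift P n A \<xi>) (C * fnorm \<xi>)"
proof -
  obtain \<alpha> where a: "\<And>j I. finite I \<Longrightarrow> (\<Sum>i\<in>I. (cmod (A i j))\<^sup>2) \<le> \<alpha>"
    using A by (auto simp: arv_iff)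
  have a0: "0 \<le> \<alpha>" using a[of "{}"] by simp
  have "fbound (shift P n A \<xi>) (sqrt \<alpha> * fnorm \<xi>)" if x: "\<xi> \<in> fock P" for \<xi>
    unfolding fbound_def
  proof (intro allI impI)
    fix k and G :: "(nat \<times> 'a) set" assume G: "finite G"
    \<comment> \<open>\<open>shift\<close> with its inner infinite sum cut down to a finite set J.
      The zero branch reproduces both defaults, degrees below n in \<open>shift\<close> and
      vanishing weights in \<open>Umap\<close>, so that \<open>V\<close> converges at every
      entry.\<close>
    define V where "V J d i = (if d < n \<or> \<not> 0 < mpow P d i k then 0
       else (\<Sum>j\<in>J. uterm n A (d - n) (\<xi> (d - n)) i k j) / complex_of_real (sqrt (mpow P d i k)))" for J d i
    have lim: "((\<lambda>J. V J d i) \<longlongrightarrow> shift P n A \<xi> d i k) (finite_subsets_at_top UNIV)" for d i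
      using infsum_tendsto[OF uterm_summable[OF A x, where m = "d - n" and i = i and k = k]]
      by (auto simp: V_def shift_def Umap_def cmmult_def intro!: tendsto_divide)
    have "((\<lambda>J. L2_set (\<lambda>(d, i). cmod (V J d i)) G)
        \<longlongrightarrow> L2_set (\<lambda>(d, i). cmod (shift P n A \<xi> d i k)) G) (finite_subsets_at_top UNIV)"
      unfolding L2_set_def case_prod_unfold by (intro tendsto_intros lim)
    moreover have bd: "L2_set (\<lambda>(d, i). cmod (V J d i)) G \<le> sqrt \<alpha> * fnorm \<xi>" if J: "finite J" for J
    proof -
      let ?D = "fst ` G" and ?I = "snd ` G"
      have V: "(cmod (V J d i))\<^sup>2 \<le> (\<Sum>j\<in>J. (cmod (A i j))\<^sup>2 * (if n \<le> d then (cmod (\<xi> (d - n) j k))\<^sup>2 else 0))" for d i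
      proof (cases "d < n \<or> \<not> 0 < mpow P d i k")
        case True
        then show ?thesis by (auto simp: V_def intro!: sum_nonneg)
      next
        case False
        let ?S = "\<Sum>j\<in>J. (cmod (A i j))\<^sup>2 * (cmod (\<xi> (d - n) j k))\<^sup>2"
        have p: "0 < mpow P d i k" and nd: "n \<le> d" using False by auto
        have "cmod (\<Sum>j\<in>J. uterm n A (d - n) (\<xi> (d - n)) i k j) \<le> sqrt (mpow P d i k) * sqrt ?S"
          using order_trans[OF norm_sum uterm_Cauchy_Schwarz[OF J, where n = n and A = A and m = "d - n" and B = "\<xi> (d - n)" and i = i and k = k]] nd by simp
        then have "cmod (V J d i) \<le> sqrt ?S"
          using False p by (simp add: V_def norm_divide divide_le_eq mult.commute)
        then have "(cmod (V J d i))\<^sup>2 \<le> (sqrt ?S)\<^sup>2" by (intro power_mono) auto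
        also have "\<dots> = ?S" by (simp add: sum_nonneg)
        finally show ?thesis using nd by simp
      qed
      have "(\<Sum>(d, i)\<in>G. (cmod (V J d i))\<^sup>2) \<le> (\<Sum>(d, i)\<in>?D \<times> ?I. (cmod (V J d i))\<^sup>2)"
        using G by (intro sum_mono2) (auto intro: rev_image_eqI)
      also have "\<dots> \<le> (\<Sum>d\<in>?D. \<Sum>i\<in>?I. \<Sum>j\<in>J. (cmod (A i j))\<^sup>2 * (if n \<le> d then (cmod (\<xi> (d - n) j k))\<^sup>2 else 0))"
        unfolding sum.cartesian_product[symmetric] by (intro sum_mono V)
      \<comment> \<open>Interchanging the sums puts i innermost, where the column bound \<alpha> of
        \<open>A\<close> applies; what is left is a finite piece of column k of \<xi>.\<close>
      also have "\<dots> = (\<Sum>d\<in>?D. \<Sum>j\<in>J. (\<Sum>i\<in>?I. (cmod (A i j))\<^sup>2) * (if n \<le> d then (cmod (\<xi> (d - n) j k))\<^sup>2 else 0))"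
        by (subst sum.swap[of _ J]) (simp only: sum_distrib_right)
      also have "\<dots> \<le> (\<Sum>d\<in>?D. \<Sum>j\<in>J. \<alpha> * (if n \<le> d then (cmod (\<xi> (d - n) j k))\<^sup>2 else 0))"
        using G by (intro sum_mono mult_right_mono a) auto
      also have "\<dots> = \<alpha> * (\<Sum>(d, j)\<in>?D \<times> J. if n \<le> d then (cmod (\<xi> (d - n) j k))\<^sup>2 else 0)"
        by (simp only: sum_distrib_left sum.cartesian_product[symmetric])
      also have "\<dots> \<le> \<alpha> * (fnorm \<xi>)\<^sup>2"
        using G J by (intro mult_left_mono shifted_sum_sq_le_fnorm[OF x] a0) auto
      finally have "sqrt (\<Sum>(d, i)\<in>G. (cmod (V J d i))\<^sup>2) \<le> sqrt (\<alpha> * (fnorm \<xi>)\<^sup>2)" by simp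
      then show ?thesis by (simp add: L2_set_def case_prod_unfold real_sqrt_mult)
    qed
    ultimately show "L2_set (\<lambda>(d, i). cmod (shift P n A \<xi> d i k)) G \<le> sqrt \<alpha> * fnorm \<xi>"
      by - (rule tendsto_upperbound, auto simp: bd intro!: eventually_finite_subsets_at_top_weakI)
  qed
  then show ?thesis by (rule that)
qed

lemma shift_bops:
  assumes A: "A \<in> arv P n"
  shows "restr P (shift P n A) \<in> bops P"
proof -
  obtain C where C: "\<And>\<xi>. \<xi> \<in> fock P \<Longrightarrow> fbound (shift P n A \<xi>) (C * fnorm \<xi>)"
    using shift_fbound[OF A] by blast
  note summ = uterm_summable[OF A]
  show ?thesis
  proof (rule bopsI[where C = C])
    fix \<xi> assume x: "\<xi> \<in> fock P"
    show "restr P (shift P n A) \<xi> \<in> fock P"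
      using x C[OF x] by (auto simp: restr_def fock_iff shift_def Umap_def)
    show "fnorm (restr P (shift P n A) \<xi>) \<le> C * fnorm \<xi>"
      using x fnorm_le[OF C[OF x]] by (simp add: restr_def)
    show "restr P (shift P n A) (fscale c \<xi>) = fscale c (restr P (shift P n A) \<xi>)" for c
    proof -
      have "cmmult X (\<lambda>j k. Y j k * (c * Z j k)) i k = c * cmmult X (\<lambda>j k. Y j k * Z j k) i k"
        for X Y Z :: "'a \<Rightarrow> 'a \<Rightarrow> complex" and i k
        unfolding cmmult_def by (subst infsum_cmult_right'[symmetric]) (simp add: algebra_simps)
      then show ?thesis
        using x fock_scale[OF x] by (simp add: restr_def shift_def Umap_def fun_eq_iff)
    qed
    show "restr P (shift P n A) (\<xi> + \<eta>) = restr P (shift P n A) \<xi> + restr P (shift P n A) \<eta>"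
      if y: "\<eta> \<in> fock P" for \<eta>
    proof -
      have "Umap P n m A ((\<xi> + \<eta>) m) i k = Umap P n m A (\<xi> m) i k + Umap P n m A (\<eta> m) i k" for m i k
        using infsum_add[OF summ[OF x, where m = m and i = i and k = k] summ[OF y, where m = m and i = i and k = k]]
        by (simp add: Umap_def cmmult_def algebra_simps add_divide_distrib)
      then show ?thesis
        using x y fock_add[OF x y] by (simp add: restr_def shift_def fun_eq_iff)
    qed
  qed (simp add: restr_def fzero_eq_0)
qed

lemma gen_alg_bops: "T \<in> gen_alg P \<Longrightarrow> T \<in> bops P"
proof (induction rule: gen_alg.induct)
  case (gen_add S T)
  then show ?case using bops_add_op[of S P T] by (simp add: plus_fun_def)
next
  case (gen_smult S c)
  then show ?case using bops_scale_op[of S P c] by (simp add: oscale_def fscale_def)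
next
  case (gen_mult S T)
  then show ?case by (intro bops_comp)
qed (simp_all add: lmult_bops shift_bops)

end

section \<open>Right creation operators and coefficients\<close>

text \<open>Right multiplication by the matrix unit E at (k, l) in degree p, that is \<xi> \<mapsto>
  U(\<xi> \<otimes> E) written out: column k is carried to column l, and the square root is what
  remains of the weights in \<open>Umap\<close>. Where \<open>mpow P d i l\<close> is 0, division by
  zero gives the value 0.\<close>

definition rcreate :: "('a \<Rightarrow> 'a \<Rightarrow> real) \<Rightarrow> nat \<Rightarrow> 'a \<Rightarrow> 'a \<Rightarrow> 'a fock_vec \<Rightarrow> 'a fock_vec" where
  "rcreate P p k l \<xi> = (\<lambda>d i j. if j = l \<and> p \<le> d
     then complex_of_real (sqrt (mpow P (d - p) i k * mpow P p k l / mpow P d i l)) * \<xi> (d - p) i k else 0)"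

text \<open>The matrix unit at (k, l) in degree p; \<open>ket 0 k k\<close> is the vacuum vector at
  k.\<close>

definition ket :: "nat \<Rightarrow> 'a \<Rightarrow> 'a \<Rightarrow> 'a fock_vec" where
  "ket p k l = (\<lambda>d i j. if d = p \<and> i = k \<and> j = l then 1 else 0)"

definition coef :: "('a fock_vec \<Rightarrow> 'a fock_vec) \<Rightarrow> nat \<Rightarrow> 'a \<Rightarrow> 'a \<Rightarrow> complex" where
  "coef T d i k = T (ket 0 k k) d i k"

definition vproj :: "('a \<Rightarrow> 'a \<Rightarrow> real) \<Rightarrow> 'a \<Rightarrow> 'a fock_vec \<Rightarrow> 'a fock_vec" where
  "vproj P k = restr P (lmult (\<lambda>i. if i = k then 1 else 0))"

definition ushift :: "('a \<Rightarrow> 'a \<Rightarrow> real) \<Rightarrow> nat \<Rightarrow> 'a \<Rightarrow> 'a \<Rightarrow> 'a fock_vec \<Rightarrow> 'a fock_vec" where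
  "ushift P p k l = restr P (shift P p (\<lambda>i j. if i = k \<and> j = l then 1 else 0))"

lemma ket_fbound: "fbound (ket p k l) 1"
proof (rule fbound_sqI)
  fix j and G :: "(nat \<times> 'a) set" assume G: "finite G"
  have "(\<Sum>(n, i)\<in>G. (cmod (ket p k l n i j))\<^sup>2) \<le> (\<Sum>x\<in>G. if x = (p, k) then 1 else 0)"
    by (intro sum_mono) (simp add: ket_def split: prod.splits)
  also have "\<dots> \<le> 1" using G by (simp add: sum.delta)
  finally show "(\<Sum>(n, i)\<in>G. (cmod (ket p k l n i j))\<^sup>2) \<le> 1\<^sup>2" by simp
qed simp

lemma ket_fock: "mpow P p k l \<noteq> 0 \<Longrightarrow> ket p k l \<in> fock P"
  using ket_fbound[of p k l] by (auto simp: fock_iff ket_def)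

lemma ket0_fock [simp]: "ket 0 k k \<in> fock P"
  by (rule ket_fock) simp

lemma cmod_coef_le:
  assumes "T \<in> bops P"
  shows "cmod (coef T d i k) \<le> op_norm P T"
proof -
  have "cmod (coef T d i k) \<le> fnorm (T (ket 0 k k))"
    unfolding coef_def by (rule cmod_le_fnorm[OF bops_fock[OF assms]])
  also have "\<dots> \<le> op_norm P T * fnorm (ket 0 k k)" by (rule fnorm_le_op_norm[OF assms ket0_fock])
  also have "\<dots> \<le> op_norm P T"
    by (rule mult_left_le[OF fnorm_le[OF ket_fbound] op_norm_nonneg[OF assms]])
  finally show ?thesis .
qed

lemma coef_eq_0: "T \<in> bops P \<Longrightarrow> mpow P d i k = 0 \<Longrightarrow> coef T d i k = 0"
  unfolding coef_def by (rule fock_eq_0[of P d i k "T (ket 0 k k)"], assumption, rule bops_fock)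

lemma coef_add: "coef (S + T) d i k = coef S d i k + coef T d i k"
  by (simp add: coef_def)

lemma coef_scale: "coef (oscale c T) d i k = c * coef T d i k"
  by (simp add: coef_def)

lemma rcreate_add: "rcreate P p k l (\<xi> + \<eta>) = rcreate P p k l \<xi> + rcreate P p k l \<eta>"
  by (simp add: rcreate_def fun_eq_iff algebra_simps)

lemma rcreate_diff: "rcreate P p k l (\<xi> - \<eta>) = rcreate P p k l \<xi> - rcreate P p k l \<eta>"
  by (simp add: rcreate_def fun_eq_iff algebra_simps)

lemma rcreate_scale: "rcreate P p k l (fscale c \<xi>) = fscale c (rcreate P p k l \<xi>)"
  by (simp add: rcreate_def fun_eq_iff)

lemma vproj_tensor_alg: "vproj P k \<in> tensor_alg P"
proof -
  have *: "bdd_above (range (\<lambda>i. cmod (if i = k then 1 else 0)))"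
    by (auto simp: bdd_above_def intro!: exI[of _ 1])
  show ?thesis unfolding vproj_def
    by (rule tensor_alg_gen[OF gen_lmult[OF *] lmult_bops[OF *]])
qed

lemma vproj_ket: "vproj P k (ket 0 l l) = (if k = l then ket 0 k k else 0)"
  by (auto simp: vproj_def restr_def lmult_def ket_def fun_eq_iff ket0_fock[unfolded ket_def])

lemma vproj_orth: "k \<noteq> l \<Longrightarrow> vproj P k \<circ> vproj P l = 0"
  by (auto simp: vproj_def restr_def lmult_def fzero_def fun_eq_iff)

lemma coef_vproj:
  assumes "T \<in> bops P"
  shows "coef (T \<circ> vproj P k) d i k = coef T d i k"
  by (simp add: coef_def vproj_ket)

context
  fixes P :: "'a \<Rightarrow> 'a \<Rightarrow> real"
  assumes P: "stochastic P"
begin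

lemma rcreate_coeff_le_1: "sqrt (mpow P m i k * mpow P p k l / mpow P (m + p) i l) \<le> 1"
proof (cases "mpow P (m + p) i l = 0")
  case False
  then have "0 < mpow P (m + p) i l" using mpow_nonneg[OF P, of "m + p" i l] by linarith
  then show ?thesis using mpow_mult_le[OF P, of m i k p l] by simp
qed simp

lemma rcreate_fbound:
  assumes "\<xi> \<in> fock P"
  shows "fbound (rcreate P p k l \<xi>) (fnorm \<xi>)"
proof (rule fbound_sqI)
  fix j and G :: "(nat \<times> 'a) set" assume G: "finite G"
  have "(cmod (rcreate P p k l \<xi> d i j))\<^sup>2 \<le> (if p \<le> d then (cmod (\<xi> (d - p) i k))\<^sup>2 else 0)" for d i
  proof (cases "j = l \<and> p \<le> d")
    case True
    let ?c = "sqrt (mpow P (d - p) i k * mpow P p k l / mpow P d i l)"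
    have "0 \<le> ?c" using mpow_nonneg[OF P] by simp
    moreover have "?c \<le> 1" using rcreate_coeff_le_1[of "d - p" i k p l] True by simp
    ultimately have "cmod (rcreate P p k l \<xi> d i j) \<le> cmod (\<xi> (d - p) i k)"
      using True by (simp add: rcreate_def norm_mult mult_left_le_one_le)
    then show ?thesis using True by (simp add: power_mono)
  qed (auto simp: rcreate_def)
  then have "(\<Sum>(d, i)\<in>G. (cmod (rcreate P p k l \<xi> d i j))\<^sup>2)
      \<le> (\<Sum>(d, i)\<in>G. if p \<le> d then (cmod (\<xi> (d - p) i k))\<^sup>2 else 0)"
    by (intro sum_mono) auto
  also have "\<dots> \<le> (fnorm \<xi>)\<^sup>2" by (rule shifted_sum_sq_le_fnorm[OF assms G])
  finally show "(\<Sum>(d, i)\<in>G. (cmod (rcreate P p k l \<xi> d i j))\<^sup>2) \<le> (fnorm \<xi>)\<^sup>2" .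
qed simp

lemma rcreate_fock: "\<xi> \<in> fock P \<Longrightarrow> rcreate P p k l \<xi> \<in> fock P"
  using rcreate_fbound[of \<xi> p k l] by (auto simp: fock_iff rcreate_def)

text \<open>If the denominator vanishes, \<open>mpow_mult_le\<close> forces the numerator to vanish
  as well, so the default value of the division does no harm.\<close>

lemma sqrt_rcreate_cancel:
  "sqrt (mpow P (m + p) i l) * sqrt (mpow P m i k * mpow P p k l / mpow P (m + p) i l)
    = sqrt (mpow P m i k) * sqrt (mpow P p k l)"
proof (cases "mpow P (m + p) i l = 0")
  case True
  then have "mpow P m i k * mpow P p k l = 0"
    using mpow_mult_le[OF P, of m i k p l] mpow_nonneg[OF P] by (metis mult_nonneg_nonneg order_antisym)
  with True show ?thesis by (metis mult_zero_left real_sqrt_mult real_sqrt_zero)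
next
  case False
  then show ?thesis by (simp flip: real_sqrt_mult)
qed

text \<open>Associativity of the maps U: multiplication by A on the left commutes with
  multiplication by a matrix unit on the right. Apart from rearranging one sum, the work lies in the
  vanishing denominators.\<close>

lemma shift_rcreate: "shift P n A (rcreate P p k l \<xi>) = rcreate P p k l (shift P n A \<xi>)"
proof (intro ext)
  fix d i j
  show "shift P n A (rcreate P p k l \<xi>) d i j = rcreate P p k l (shift P n A \<xi>) d i j"
  proof (cases "j = l \<and> n + p \<le> d")
    case False
    then have "rcreate P p k l \<xi> (d - n) x j = 0 \<or> d < n" for x by (auto simp: rcreate_def)
    then have "shift P n A (rcreate P p k l \<xi>) d i j = 0"
      by (auto simp: shift_def Umap_def cmmult_def)
    moreover have "rcreate P p k l (shift P n A \<xi>) d i j = 0"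
      using False by (auto simp: rcreate_def shift_def)
    ultimately show ?thesis by simp
  next
    case True
    define m where "m = d - n - p"
    have d: "d = n + (m + p)" and j: "j = l" using True by (auto simp: m_def)
    define c where "c = cmmult (\<lambda>i j. complex_of_real (sqrt (mpow P n i j)) * A i j)
        (\<lambda>j k. complex_of_real (sqrt (mpow P m j k)) * \<xi> m j k) i k"
    have eq: "complex_of_real (sqrt (mpow P (m + p) x l)) * rcreate P p k l \<xi> (m + p) x l
        = complex_of_real (sqrt (mpow P p k l)) * (complex_of_real (sqrt (mpow P m x k)) * \<xi> m x k)" for x
    proof -
      have "complex_of_real (sqrt (mpow P (m + p) x l)) * rcreate P p k l \<xi> (m + p) x l
        = complex_of_real (sqrt (mpow P (m + p) x l) * sqrt (mpow P m x k * mpow P p k l / mpow P (m + p) x l)) * \<xi> m x k"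
        by (simp add: rcreate_def)
      also have "\<dots> = complex_of_real (sqrt (mpow P p k l)) * (complex_of_real (sqrt (mpow P m x k)) * \<xi> m x k)"
        by (subst sqrt_rcreate_cancel) simp
      finally show ?thesis .
    qed
    have "cmmult (\<lambda>i j. complex_of_real (sqrt (mpow P n i j)) * A i j)
        (\<lambda>j k'. complex_of_real (sqrt (mpow P (m + p) j k')) * rcreate P p k l \<xi> (m + p) j k') i l
      = complex_of_real (sqrt (mpow P p k l)) * c"
      unfolding cmmult_def c_def eq infsum_cmult_right'[symmetric]
      by (intro infsum_cong) (simp add: mult_ac)
    then have lhs: "shift P n A (rcreate P p k l \<xi>) d i j
      = (if 0 < mpow P d i l then complex_of_real (sqrt (mpow P p k l)) * c / complex_of_real (sqrt (mpow P d i l)) else 0)"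
      by (simp add: shift_def Umap_def d j)
    have rhs: "rcreate P p k l (shift P n A \<xi>) d i j
      = complex_of_real (sqrt (mpow P (n + m) i k * mpow P p k l / mpow P d i l))
        * (if 0 < mpow P (n + m) i k then c / complex_of_real (sqrt (mpow P (n + m) i k)) else 0)"
    proof -
      have "d - p = n + m" "p \<le> d" by (auto simp: d)
      then show ?thesis by (simp add: rcreate_def shift_def Umap_def c_def j)
    qed
    show ?thesis
    proof (cases "0 < mpow P d i l")
      case False
      then have "mpow P d i l = 0" using mpow_nonneg[OF P, of d i l] by linarith
      then show ?thesis unfolding lhs rhs by simp
    next
      case pos: True
      show ?thesis
      proof (cases "0 < mpow P (n + m) i k")
        case True
        with pos show ?thesis unfolding lhs rhs
          by (simp add: real_sqrt_mult real_sqrt_divide)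
      next
        case False
        \<comment> \<open>The left side does not fall back on a default here, as
          \<open>mpow P d i l\<close> is positive. But no path from i to k through x has positive
          weight, so every summand of \<open>c\<close> vanishes.\<close>
        have "mpow P n i x * mpow P m x k = 0" for x
          using False mpow_mult_le[OF P, of n i x m k] mpow_nonneg[OF P, of n i x] mpow_nonneg[OF P, of m x k]
          by (metis less_eq_real_def mult_nonneg_nonneg order_trans not_le order_antisym)
        then have "sqrt (mpow P n i x) = 0 \<or> sqrt (mpow P m x k) = 0" for x by simp
        then have "c = 0" unfolding c_def cmmult_def
          by (intro infsum_0) (metis mult_zero_left mult_zero_right of_real_0)
        then show ?thesis unfolding lhs rhs by simp
      qed
    qed
  qed
qed

lemma gen_alg_rcreate:
  "T \<in> gen_alg P \<Longrightarrow> \<xi> \<in> fock P \<Longrightarrow> T (rcreate P p k l \<xi>) = rcreate P p k l (T \<xi>)"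
proof (induction arbitrary: \<xi> rule: gen_alg.induct)
  case (gen_lmult a)
  then show ?case using rcreate_fock[OF gen_lmult(2), of p k l]
    by (simp add: restr_def lmult_def rcreate_def fun_eq_iff)
next
  case (gen_shift n A)
  then show ?case using rcreate_fock[OF gen_shift(3), of p k l] by (simp add: restr_def shift_rcreate)
next
  case (gen_add S T)
  then show ?case using rcreate_add[of P p k l "S \<xi>" "T \<xi>"] by (simp add: plus_fun_def)
next
  case (gen_smult S c)
  then show ?case using rcreate_scale[of P p k l c "S \<xi>"] by (simp add: fscale_def)
next
  case (gen_mult S T)
  then show ?case using bops_fock[OF gen_alg_bops[OF P gen_mult(2)]] by simp
qed

text \<open>Commutation survives norm limits: an approximant S commutes with right creation, so the
  commutator of T equals that of T - S, and right creation is a contraction. This leaves at most 2 *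
  \<epsilon> * \<open>fnorm \<xi>\<close>.\<close>

lemma tensor_alg_rcreate:
  assumes T: "T \<in> tensor_alg P" and x: "\<xi> \<in> fock P"
  shows "T (rcreate P p k l \<xi>) = rcreate P p k l (T \<xi>)"
proof (intro ext)
  fix d i j
  let ?R = "rcreate P p k l"
  have "cmod (T (?R \<xi>) d i j - ?R (T \<xi>) d i j) \<le> \<epsilon> * (2 * fnorm \<xi>)" if "\<epsilon> > 0" for \<epsilon>
  proof -
    obtain S where S: "S \<in> gen_alg P" "S \<in> bops P" "op_norm P (T - S) < \<epsilon>"
      using T \<open>\<epsilon> > 0\<close> by (auto simp: tensor_alg_iff)
    let ?D = "T - S"
    have D: "?D \<in> bops P" using T S(2) by (simp add: bops_diff_op tensor_alg_bops)
    have "cmod (?D (?R \<xi>) d i j) \<le> fnorm (?D (?R \<xi>))" by (rule cmod_le_fnorm[OF bops_fock[OF D]])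
    also have "\<dots> \<le> op_norm P ?D * fnorm (?R \<xi>)" by (rule fnorm_le_op_norm[OF D rcreate_fock[OF x]])
    also have "\<dots> \<le> \<epsilon> * fnorm \<xi>"
      using S(3) fnorm_le[OF rcreate_fbound[OF x]] op_norm_nonneg[OF D] by (intro mult_mono) auto
    finally have 1: "cmod (?D (?R \<xi>) d i j) \<le> \<epsilon> * fnorm \<xi>" .
    have "cmod (?R (?D \<xi>) d i j) \<le> fnorm (?R (?D \<xi>))"
      by (rule cmod_le_fnorm[OF rcreate_fock[OF bops_fock[OF D]]])
    also have "\<dots> \<le> fnorm (?D \<xi>)" by (rule fnorm_le[OF rcreate_fbound[OF bops_fock[OF D]]])
    also have "\<dots> \<le> op_norm P ?D * fnorm \<xi>" by (rule fnorm_le_op_norm[OF D x])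
    also have "\<dots> \<le> \<epsilon> * fnorm \<xi>" using S(3) by (intro mult_right_mono) auto
    finally have 2: "cmod (?R (?D \<xi>) d i j) \<le> \<epsilon> * fnorm \<xi>" .
    have "?R (?D \<xi>) = ?R (T \<xi>) - S (?R \<xi>)"
      unfolding minus_apply rcreate_diff gen_alg_rcreate[OF S(1) x] ..
    then have "T (?R \<xi>) d i j - ?R (T \<xi>) d i j = ?D (?R \<xi>) d i j - ?R (?D \<xi>) d i j"
      by simp
    also have "cmod \<dots> \<le> \<epsilon> * fnorm \<xi> + \<epsilon> * fnorm \<xi>"
      by (rule order_trans[OF norm_triangle_ineq4 add_mono[OF 1 2]])
    finally show ?thesis by (simp add: algebra_simps)
  qed
  then have le: "cmod (T (?R \<xi>) d i j - ?R (T \<xi>) d i j) \<le> \<epsilon> * (2 * fnorm \<xi>)" if "\<epsilon> > 0" for \<epsilon>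
    using that by blast
  have "((\<lambda>\<epsilon>. \<epsilon> * (2 * fnorm \<xi>)) \<longlongrightarrow> 0 * (2 * fnorm \<xi>)) (at_right 0)"
    by (intro tendsto_intros)
  then have "cmod (T (?R \<xi>) d i j - ?R (T \<xi>) d i j) \<le> 0 * (2 * fnorm \<xi>)"
    by (rule tendsto_lowerbound) (auto simp: eventually_at_right_field intro!: exI[of _ 1] le)
  then show "T (?R \<xi>) d i j = ?R (T \<xi>) d i j" by simp
qed

lemma rcreate_ket:
  assumes "mpow P p k l \<noteq> 0"
  shows "rcreate P p k l (ket 0 k k) = ket p k l"
  using assms by (auto simp: rcreate_def ket_def fun_eq_iff)

text \<open>The matrix unit is the vacuum at k moved by right creation, so its image under T is
  governed by the coefficients of T at k, moved up by p degrees.\<close>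

lemma tensor_alg_ket:
  assumes "T \<in> tensor_alg P" "mpow P p k l \<noteq> 0"
  shows "T (ket p k l) d i j = (if j = l \<and> p \<le> d
     then complex_of_real (sqrt (mpow P (d - p) i k * mpow P p k l / mpow P d i l)) * coef T (d - p) i k else 0)"
  using tensor_alg_rcreate[OF assms(1) ket0_fock, of p k l k] rcreate_ket[OF assms(2)]
  by (simp add: rcreate_def coef_def)

lemma ushift_tensor_alg:
  assumes "1 \<le> p" "mpow P p k l \<noteq> 0"
  shows "ushift P p k l \<in> tensor_alg P"
proof -
  have "(\<Sum>i\<in>I. (cmod (if i = k \<and> j = l then 1 else 0))\<^sup>2) \<le> 1" if "finite I" for I j
  proof -
    have "(\<Sum>i\<in>I. (cmod (if i = k \<and> j = l then 1 else 0))\<^sup>2) \<le> (\<Sum>i\<in>I. if i = k then 1 else 0)"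
      by (intro sum_mono) auto
    also have "\<dots> \<le> 1" using that by (simp add: sum.delta)
    finally show ?thesis .
  qed
  then have A: "(\<lambda>i j. if i = k \<and> j = l then 1 else 0) \<in> arv P p"
    using assms(2) unfolding arv_iff by auto
  show ?thesis unfolding ushift_def
    by (rule tensor_alg_gen[OF gen_shift[OF assms(1) A] shift_bops[OF P A]])
qed

text \<open>A left shift at the vacuum of l and right creation at the vacuum of k produce the same
  matrix unit. This coincidence turns right multiplication within the algebra into a move of
  coefficients from k to l.\<close>

lemma ushift_ket:
  assumes "mpow P p k l \<noteq> 0"
  shows "ushift P p k l (ket 0 l l) = ket p k l"
proof (intro ext)
  fix d i j
  have pos: "0 < mpow P p k l" using assms mpow_nonneg[OF P, of p k l] by linarith
  let ?A = "\<lambda>i j. if i = k \<and> j = l then 1 else 0 :: complex"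
  have "cmmult (\<lambda>i j. complex_of_real (sqrt (mpow P p i j)) * ?A i j)
      (\<lambda>j k. complex_of_real (sqrt (mpow P (d - p) j k)) * ket 0 l l (d - p) j k) i j
    = (if d - p = 0 \<and> i = k \<and> j = l then complex_of_real (sqrt (mpow P p k l)) else 0)"
    unfolding cmmult_def
    by (rule infsumI, rule has_sum_finite_neutralI[of "{l}"]) (auto simp: ket_def)
  then have "shift P p ?A (ket 0 l l) d i j = ket p k l d i j"
    using pos by (auto simp: shift_def Umap_def ket_def)
  then show "ushift P p k l (ket 0 l l) d i j = ket p k l d i j"
    by (simp add: ushift_def restr_def)
qed

text \<open>The factor is independent of T, and the row i is kept while the degree rises by p. This
  drives both the spread of badness along edges and the descent in degree on cycles.\<close>

lemma coef_ushift:
  assumes "T \<in> tensor_alg P" "mpow P p k l \<noteq> 0"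
  shows "coef (T \<circ> ushift P p k l) d i l = (if p \<le> d
     then complex_of_real (sqrt (mpow P (d - p) i k * mpow P p k l / mpow P d i l)) * coef T (d - p) i k else 0)"
  using tensor_alg_ket[OF assms] by (simp add: coef_def ushift_ket[OF assms(2)])

end

section \<open>Dominated functionals and uniform boundedness\<close>

text \<open>A one-sided estimate is enough for seminorms; C carries no sign, which
  \<open>dominatedE\<close> repairs.\<close>

definition dominated :: "('a \<Rightarrow> 'a \<Rightarrow> real) \<Rightarrow> (('a fock_vec \<Rightarrow> 'a fock_vec) \<Rightarrow> real) \<Rightarrow> bool" where
  "dominated Q f \<longleftrightarrow> (\<exists>C. \<forall>a\<in>tensor_alg Q. f a \<le> C * op_norm Q a)"

lemma op_norm_tensor_nonneg: "a \<in> tensor_alg Q \<Longrightarrow> 0 \<le> op_norm Q a"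
  by (intro op_norm_nonneg tensor_alg_bops)

lemma dominatedE:
  assumes "dominated Q f"
  obtains C where "0 \<le> C" "\<And>a. a \<in> tensor_alg Q \<Longrightarrow> f a \<le> C * op_norm Q a"
proof -
  obtain C where C: "\<forall>a\<in>tensor_alg Q. f a \<le> C * op_norm Q a" using assms dominated_def by blast
  have "f a \<le> \<bar>C\<bar> * op_norm Q a" if "a \<in> tensor_alg Q" for a
    using C that op_norm_tensor_nonneg[OF that] by (meson abs_ge_self mult_right_mono order_trans)
  then show ?thesis using that[of "\<bar>C\<bar>"] by auto
qed

lemma dominatedI: "(\<And>a. a \<in> tensor_alg Q \<Longrightarrow> f a \<le> C * op_norm Q a) \<Longrightarrow> dominated Q f"
  by (auto simp: dominated_def)

lemma dominated_add:
  assumes "dominated Q f" "dominated Q g" "\<And>a. a \<in> tensor_alg Q \<Longrightarrow> h a \<le> f a + g a"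
  shows "dominated Q h"
proof -
  obtain C D where CD: "\<And>a. a \<in> tensor_alg Q \<Longrightarrow> f a \<le> C * op_norm Q a"
    "\<And>a. a \<in> tensor_alg Q \<Longrightarrow> g a \<le> D * op_norm Q a"
    using assms(1,2) unfolding dominated_def by blast
  have "h a \<le> (C + D) * op_norm Q a" if "a \<in> tensor_alg Q" for a
    using add_mono[OF CD(1)[OF that] CD(2)[OF that]] assms(3)[OF that] by (simp add: distrib_right)
  then show ?thesis by (rule dominatedI)
qed

lemma dominated_scale:
  assumes "dominated Q f" "0 \<le> c" "\<And>a. a \<in> tensor_alg Q \<Longrightarrow> h a \<le> c * f a"
  shows "dominated Q h"
proof -
  obtain C where C: "\<And>a. a \<in> tensor_alg Q \<Longrightarrow> f a \<le> C * op_norm Q a"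
    using assms(1) dominated_def by blast
  have "h a \<le> (c * C) * op_norm Q a" if "a \<in> tensor_alg Q" for a
    using order_trans[OF assms(3)[OF that] mult_left_mono[OF C[OF that] assms(2)]] by (simp add: mult.assoc)
  then show ?thesis by (rule dominatedI)
qed

lemma dominated_0: "(\<And>a. a \<in> tensor_alg Q \<Longrightarrow> h a \<le> 0) \<Longrightarrow> dominated Q h"
  by (rule dominatedI[where C = 0]) simp

lemma dominated_sum:
  assumes "\<And>x. x \<in> G \<Longrightarrow> dominated Q (f x)"
  shows "dominated Q (\<lambda>a. \<Sum>x\<in>G. f x a)"
  using assms
proof (induction G rule: infinite_finite_induct)
  case (insert x G)
  show ?case
  proof (rule dominated_add)
    show "dominated Q (f x)" by (rule insert.prems) simp
    show "dominated Q (\<lambda>a. \<Sum>x\<in>G. f x a)" by (rule insert.IH[OF insert.prems]) simp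
  qed (simp add: insert.hyps)
qed (simp_all add: dominated_0)

text \<open>An unbounded homogeneous functional takes large values on arbitrarily small balls. This
  supplies the \<open>pick\<close> premise of the two humps that concern \<phi>.\<close>

lemma undominated_pick:
  assumes und: "\<not> dominated Q f" and hom: "\<And>a c. a \<in> tensor_alg Q \<Longrightarrow> f (oscale c a) = cmod c * f a"
    and d: "0 < \<delta>"
  shows "\<exists>a\<in>tensor_alg Q. op_norm Q a \<le> \<delta> \<and> K \<le> f a"
proof -
  \<comment> \<open>After rescaling a to norm \<delta>, its value is at least C * \<delta> = |K| +
    1; the modulus keeps C positive for negative K.\<close>
  define C where "C = (\<bar>K\<bar> + 1) / \<delta>"
  have C: "0 < C" using d by (simp add: C_def)
  obtain a where a: "a \<in> tensor_alg Q" "C * op_norm Q a < f a"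
    using und unfolding dominated_def not_ex not_all by (auto simp: not_le)
  have n: "op_norm Q a > 0"
  proof (rule ccontr)
    assume "\<not> op_norm Q a > 0"
    then have "a = 0" using op_norm_eq_0D[OF tensor_alg_bops[OF a(1)]] by simp
    moreover have "oscale 0 (0 :: 'a fock_vec \<Rightarrow> 'a fock_vec) = 0" by (simp add: fun_eq_iff)
    ultimately have "f a = 0" using hom[OF tensor_alg_0, of 0] by simp
    moreover have "0 \<le> C * op_norm Q a" using C op_norm_tensor_nonneg[OF a(1)] by simp
    ultimately show False using a(2) by linarith
  qed
  define t where "t = \<delta> / op_norm Q a"
  have t: "t > 0" using d n by (simp add: t_def)
  have "op_norm Q (oscale (of_real t) a) \<le> cmod (of_real t) * op_norm Q a"
    by (rule op_norm_scale_le[OF tensor_alg_bops[OF a(1)]])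
  also have "\<dots> = t * op_norm Q a" using t by simp
  also have "\<dots> = \<delta>" using n by (simp add: t_def)
  finally have "op_norm Q (oscale (of_real t) a) \<le> \<delta>" .
  moreover have "K \<le> f (oscale (of_real t) a)"
  proof -
    have "K \<le> C * \<delta>" using d by (simp add: C_def)
    also have "\<dots> = t * (C * op_norm Q a)" using n by (simp add: t_def)
    also have "\<dots> \<le> t * f a" using a(2) t by simp
    also have "\<dots> = f (oscale (of_real t) a)" using hom[OF a(1), of "of_real t"] t by simp
    finally show ?thesis .
  qed
  ultimately show ?thesis using tensor_alg_scale[OF a(1)] by blast
qed

text \<open>The step choosing the sign of each perturbation is Sokal's trick, which avoids the Baire category theorem.\<close>

lemma uniform_boundedness:
  fixes Q :: "'a \<Rightarrow> 'a \<Rightarrow> real" and q :: "'i \<Rightarrow> ('a fock_vec \<Rightarrow> 'a fock_vec) \<Rightarrow> real"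
  assumes tri: "\<And>\<alpha> x y. \<alpha> \<in> \<Lambda> \<Longrightarrow> x \<in> tensor_alg Q \<Longrightarrow> y \<in> tensor_alg Q \<Longrightarrow> q \<alpha> (x + y) \<le> q \<alpha> x + q \<alpha> y"
    and hom: "\<And>\<alpha> x c. \<alpha> \<in> \<Lambda> \<Longrightarrow> x \<in> tensor_alg Q \<Longrightarrow> q \<alpha> (oscale c x) = cmod c * q \<alpha> x"
    and dom: "\<And>\<alpha>. \<alpha> \<in> \<Lambda> \<Longrightarrow> dominated Q (q \<alpha>)"
    and ptw: "\<And>x. x \<in> tensor_alg Q \<Longrightarrow> \<exists>B. \<forall>\<alpha>\<in>\<Lambda>. q \<alpha> x \<le> B"
  shows "\<exists>C. \<forall>\<alpha>\<in>\<Lambda>. \<forall>x\<in>tensor_alg Q. q \<alpha> x \<le> C * op_norm Q x"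
proof (rule ccontr)
  assume "\<not> ?thesis"
  then have bad: "\<exists>\<alpha>\<in>\<Lambda>. \<exists>x\<in>tensor_alg Q. C * op_norm Q x < q \<alpha> x" for C
    by (auto simp: not_le)
  let ?X = "tensor_alg Q"
  \<comment> \<open>N is the norm of q \<alpha>, namely \<open>Sup ?S\<close>, and e is an element
    of the unit ball at which half of it is reached. Half is enough, because the tail will cost only
    a third.\<close>
  have near: "\<exists>\<alpha> N e. \<alpha> \<in> \<Lambda> \<and> (\<forall>x\<in>?X. q \<alpha> x \<le> N * op_norm Q x) \<and> K \<le> N \<and> e \<in> ?X
      \<and> op_norm Q e \<le> 1 \<and> N / 2 \<le> q \<alpha> e" if K: "0 < K" for K
  proof -
    obtain \<alpha> x where \<alpha>: "\<alpha> \<in> \<Lambda>" and x: "x \<in> ?X" "K * op_norm Q x < q \<alpha> x" using bad by blast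
    obtain D where D: "0 \<le> D" "\<And>a. a \<in> ?X \<Longrightarrow> q \<alpha> a \<le> D * op_norm Q a"
      using dominatedE[OF dom[OF \<alpha>]] by blast
    let ?S = "{q \<alpha> a | a. a \<in> ?X \<and> op_norm Q a \<le> 1}"
    have "q \<alpha> a \<le> D" if "a \<in> ?X" "op_norm Q a \<le> 1" for a
      using D(2)[OF that(1)] mult_left_mono[OF that(2) D(1)] by simp
    then have bdd: "bdd_above ?S" by (auto simp: bdd_above_def)
    have up: "q \<alpha> a \<le> Sup ?S" if "a \<in> ?X" "op_norm Q a \<le> 1" for a
      using that by (intro cSup_upper[OF _ bdd]) auto
    have le: "q \<alpha> a \<le> Sup ?S * op_norm Q a" if a: "a \<in> ?X" for a
    proof (cases "op_norm Q a = 0")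
      case True
      with D(2)[OF a] show ?thesis by simp
    next
      case False
      then have n: "op_norm Q a > 0" using op_norm_tensor_nonneg[OF a] by simp
      let ?b = "oscale (of_real (1 / op_norm Q a)) a"
      have "op_norm Q ?b \<le> 1"
        using op_norm_scale_le[OF tensor_alg_bops[OF a], of "of_real (1 / op_norm Q a)"] n
        by (simp add: norm_divide)
      then have "q \<alpha> ?b \<le> Sup ?S" using up tensor_alg_scale[OF a] by blast
      then show ?thesis using hom[OF \<alpha> a, of "of_real (1 / op_norm Q a)"] n
        by (simp add: norm_divide divide_le_eq)
    qed
    have KS: "K \<le> Sup ?S"
    proof (rule ccontr)
      assume "\<not> K \<le> Sup ?S"
      then have "Sup ?S * op_norm Q x \<le> K * op_norm Q x"
        using op_norm_tensor_nonneg[OF x(1)] by (intro mult_right_mono) auto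
      with le[OF x(1)] x(2) show False by linarith
    qed
    have "?S \<noteq> {}" using tensor_alg_0[of Q] by (auto intro!: exI[of _ 0])
    moreover have "Sup ?S / 2 < Sup ?S" using KS K by simp
    ultimately have "\<exists>s\<in>?S. Sup ?S / 2 < s" using less_cSup_iff[OF _ bdd] by blast
    then obtain e where "e \<in> ?X" "op_norm Q e \<le> 1" "Sup ?S / 2 \<le> q \<alpha> e" by fastforce
    with \<alpha> le KS show ?thesis by blast
  qed
  \<comment> \<open>At the end N / 2 - N / 3 = N / 6 is multiplied by (1/4)^n and has to be at least
    n + 1; this fixes the lower bound on N.\<close>
  have "\<forall>n. \<exists>\<alpha> N e. \<alpha> \<in> \<Lambda> \<and> (\<forall>x\<in>?X. q \<alpha> x \<le> N * op_norm Q x) \<and> 6 * (real n + 1) * 4 ^ n \<le> N \<and> e \<in> ?X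
      \<and> op_norm Q e \<le> 1 \<and> N / 2 \<le> q \<alpha> e"
    by (intro allI near) simp
  then obtain \<alpha> N e where \<alpha>: "\<And>n. \<alpha> n \<in> \<Lambda>" and N: "\<And>n x. x \<in> ?X \<Longrightarrow> q (\<alpha> n) x \<le> N n * op_norm Q x"
    and big: "\<And>n. 6 * (real n + 1) * 4 ^ n \<le> N n"
    and e: "\<And>n. e n \<in> ?X" "\<And>n. op_norm Q (e n) \<le> 1" "\<And>n. N n / 2 \<le> q (\<alpha> n) (e n)"
    by metis
  have "\<exists>x\<in>?X. \<forall>n. N n / 2 * (1/4)^n - N n / 3 * (1/4)^n \<le> q (\<alpha> n) x"
  proof (rule gliding_hump[where D = "\<lambda>n. {a \<in> ?X. op_norm Q a \<le> (1/4)^n}" and M = "\<lambda>n a. a"])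
    fix n y assume y: "y \<in> ?X"
    let ?e = "oscale (of_real ((1/4)^n)) (e n)" and ?f = "oscale (- of_real ((1/4)^n)) (e n)"
    note sc = tensor_alg_scale[OF e(1)]
    have hom_n: "q (\<alpha> n) (oscale c z) = cmod c * q (\<alpha> n) z" if "z \<in> ?X" for c z
      by (rule hom[OF \<alpha> that])
    have nrm: "op_norm Q (oscale c (e n)) \<le> cmod c" for c
    proof -
      have "op_norm Q (oscale c (e n)) \<le> cmod c * op_norm Q (e n)"
        by (rule op_norm_scale_le[OF tensor_alg_bops[OF e(1)]])
      also have "\<dots> \<le> cmod c * 1" by (intro mult_left_mono e(2)) simp
      finally show ?thesis by simp
    qed
    have "oscale 2 ?e = (y + ?e) + oscale (-1) (y + ?f)" by (simp add: fun_eq_iff algebra_simps)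
    then have "q (\<alpha> n) (oscale 2 ?e) \<le> q (\<alpha> n) (y + ?e) + q (\<alpha> n) (oscale (-1) (y + ?f))"
      using tri[OF \<alpha> tensor_alg_add[OF y sc] tensor_alg_scale[OF tensor_alg_add[OF y sc]]] by simp
    then have "2 * q (\<alpha> n) ?e \<le> q (\<alpha> n) (y + ?e) + q (\<alpha> n) (y + ?f)"
      by (simp add: hom_n sc tensor_alg_add y del: of_real_power)
    then have "q (\<alpha> n) ?e \<le> q (\<alpha> n) (y + ?e) \<or> q (\<alpha> n) ?e \<le> q (\<alpha> n) (y + ?f)" by linarith
    moreover have "N n / 2 * (1/4)^n \<le> q (\<alpha> n) ?e"
      using mult_right_mono[OF e(3)[of n], of "(1/4)^n"] hom_n[OF e(1)[of n], of "of_real ((1/4)^n)"]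
      by (simp add: norm_power norm_divide mult.commute)
    moreover have "op_norm Q ?e \<le> (1/4)^n" "op_norm Q ?f \<le> (1/4)^n"
      using nrm[of "of_real ((1/4)^n)"] nrm[of "- of_real ((1/4)^n)"] by (simp_all add: norm_power norm_divide)
    ultimately obtain f where "f \<in> {?e, ?f}" "N n / 2 * (1/4)^n \<le> q (\<alpha> n) (y + f)" "op_norm Q f \<le> (1/4)^n"
      using order_trans by blast
    then show "\<exists>a\<in>{a \<in> ?X. op_norm Q a \<le> (1/4)^n}. N n / 2 * (1/4)^n \<le> q (\<alpha> n) (y + a)"
      using sc[of _ n] by blast
  next
    fix a :: "nat \<Rightarrow> 'a fock_vec \<Rightarrow> 'a fock_vec" assume a: "\<And>n. a n \<in> {a \<in> ?X. op_norm Q a \<le> (1/4)^n}"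
    obtain x where x: "x \<in> ?X" "\<And>N. op_norm Q (x - sum a {..<N}) \<le> 4/3 * (1/4)^N"
      using tensor_alg_series[of a Q] a by blast
    have "q (\<alpha> n) (sum a {..n}) - N n / 3 * (1/4)^n \<le> q (\<alpha> n) x" for n
    proof -
      let ?s = "sum a {..n}"
      have s: "?s \<in> ?X" using a by (intro tensor_alg_sum) auto
      have d: "x - ?s \<in> ?X" by (rule tensor_alg_diff[OF x(1) s])
      have "?s = x + oscale (-1) (x - ?s)" by (simp add: fun_eq_iff)
      then have "q (\<alpha> n) ?s \<le> q (\<alpha> n) x + q (\<alpha> n) (oscale (-1) (x - ?s))"
        using tri[OF \<alpha> x(1) tensor_alg_scale[OF d]] by metis
      also have "q (\<alpha> n) (oscale (-1) (x - ?s)) = q (\<alpha> n) (x - ?s)"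
        using hom[OF \<alpha> d] by simp
      also have "q (\<alpha> n) (x - ?s) \<le> N n * op_norm Q (x - ?s)" by (rule N[OF d])
      \<comment> \<open>4/3 * (1/4)^Suc n = (1/4)^n / 3: ratio 1/4 makes the whole tail smaller than
        half of the n-th step.\<close>
      also have "\<dots> \<le> N n * (4/3 * (1/4)^Suc n)"
      proof (rule mult_left_mono)
        show "op_norm Q (x - ?s) \<le> 4/3 * (1/4)^Suc n" using x(2)[of "Suc n"] by (simp only: lessThan_Suc_atMost)
        have "0 \<le> 6 * (real n + 1) * 4 ^ n" by simp
        then show "0 \<le> N n" using big[of n] by linarith
      qed
      finally show ?thesis by simp
    qed
    with x(1) show "\<exists>x\<in>?X. \<forall>n. q (\<alpha> n) (\<Sum>k\<le>n. a k) - N n / 3 * (1/4)^n \<le> q (\<alpha> n) x" by blast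
  qed (auto simp: tensor_alg_0 tensor_alg_add)
  then obtain x where x: "x \<in> ?X" "\<And>n. N n / 2 * (1/4)^n - N n / 3 * (1/4)^n \<le> q (\<alpha> n) x" by blast
  obtain B where B: "\<forall>\<alpha>\<in>\<Lambda>. q \<alpha> x \<le> B" using ptw[OF x(1)] by blast
  have "real n + 1 \<le> B" for n
  proof -
    have "real n + 1 = 6 * (real n + 1) * 4 ^ n / 6 * (1/4)^n" by (simp add: power_divide)
    also have "\<dots> \<le> N n / 6 * (1/4)^n" using big[of n] by (intro mult_right_mono divide_right_mono) auto
    also have "\<dots> = N n / 2 * (1/4)^n - N n / 3 * (1/4)^n" by (simp add: field_simps)
    also have "\<dots> \<le> B" using x(2)[of n] B \<alpha>[of n] by force
    finally show ?thesis .
  qed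
  moreover obtain n where "B < real n" using reals_Archimedean2 by blast
  ultimately show False by (smt (verit))
qed

section \<open>Bad states\<close>

lemma comp_add_left: "(S + T) \<circ> R = (S \<circ> R) + (T \<circ> R)" for S T :: "'a fock_vec \<Rightarrow> 'a fock_vec"
  by (simp add: fun_eq_iff)

lemma comp_diff_left: "(S - T) \<circ> R = (S \<circ> R) - (T \<circ> R)" for S T :: "'a fock_vec \<Rightarrow> 'a fock_vec"
  by (simp add: fun_eq_iff)

lemma comp_sum_left: "sum u A \<circ> R = (\<Sum>k\<in>A. u k \<circ> R)" for u :: "'k \<Rightarrow> 'a fock_vec \<Rightarrow> 'a fock_vec"
  by (simp add: fun_eq_iff sum_apply)

lemma comp_0_right: "T \<in> bops P \<Longrightarrow> T \<circ> 0 = 0"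
  by (simp add: fun_eq_iff bops_app_0)

text \<open>Turns a comparison of partial sums into an exact identity between limits, which \<phi>
  can then transport.\<close>

lemma eq_0_if_geometric:
  assumes T: "T \<in> bops Q" and le: "\<And>N. N0 \<le> N \<Longrightarrow> op_norm Q T \<le> C * (1/4)^N"
  shows "T = 0"
proof (rule op_norm_eq_0D[OF T])
  have "(\<lambda>N. C * (1/4)^N) \<longlonglongrightarrow> C * (0::real)"
    by (intro tendsto_intros LIMSEQ_realpow_zero) auto
  then have "op_norm Q T \<le> C * 0"
    by (rule LIMSEQ_le_const) (use le in blast)
  then show "op_norm Q T \<le> 0" by simp
qed

text \<open>The power \<open>b ^^ 0\<close> is \<open>id\<close>, which does not vanish outside the
  Fock space and so is not in \<open>bops\<close>. Powers are therefore handled as right factors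
  \<open>a \<circ> (b ^^ n)\<close>, and inductions on n absorb one b into a.\<close>

lemma comp_funpow_Suc: "a \<circ> (b ^^ Suc n) = (a \<circ> b) \<circ> (b ^^ n)"
  by (simp add: fun_eq_iff)

lemma tensor_alg_comp_funpow: "a \<in> tensor_alg P \<Longrightarrow> b \<in> tensor_alg P \<Longrightarrow> a \<circ> (b ^^ n) \<in> tensor_alg P"
proof (induction n arbitrary: a)
  case (Suc n)
  then show ?case unfolding comp_funpow_Suc by (intro Suc.IH tensor_alg_comp)
qed simp

lemma op_norm_comp_funpow:
  assumes "a \<in> tensor_alg P" "b \<in> tensor_alg P"
  shows "op_norm P (a \<circ> (b ^^ n)) \<le> op_norm P a * op_norm P b ^ n"
  using assms(1)
proof (induction n arbitrary: a)
  case (Suc n)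
  have "op_norm P (a \<circ> (b ^^ Suc n)) \<le> op_norm P (a \<circ> b) * op_norm P b ^ n"
    unfolding comp_funpow_Suc by (intro Suc.IH tensor_alg_comp Suc.prems assms(2))
  also have "\<dots> \<le> (op_norm P a * op_norm P b) * op_norm P b ^ n"
    using Suc.prems assms(2) by (intro mult_right_mono op_norm_comp zero_le_power op_norm_nonneg tensor_alg_bops)
  finally show ?case by (simp only: power_Suc mult.assoc)
qed simp

lemma mpow_1:
  assumes "stochastic P"
  shows "mpow P 1 k l = P k l"
proof -
  have "((\<lambda>j. mpow P 0 k j * P j l) has_sum P k l) UNIV"
    by (rule has_sum_finite_neutralI[of "{k}"]) auto
  with mpow_Suc_has_sum[OF assms, of 0 k l] show ?thesis
    by (metis One_nat_def has_sum_unique)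
qed

lemma rcreate_coeff_pos:
  assumes P: "stochastic P" and "mpow P m i k \<noteq> 0" "mpow P p k l \<noteq> 0"
  shows "0 < sqrt (mpow P m i k * mpow P p k l / mpow P (m + p) i l)"
proof -
  have "0 < mpow P m i k" "0 < mpow P p k l"
    using assms mpow_nonneg[OF P] by (simp_all add: order_less_le)
  then have "0 < mpow P m i k * mpow P p k l" by simp
  moreover from this have "0 < mpow P (m + p) i l"
    using mpow_mult_le[OF P, of m i k p l] by linarith
  ultimately show ?thesis by simp
qed

context
  fixes P Q :: "'a \<Rightarrow> 'a \<Rightarrow> real" and \<phi> :: "('a fock_vec \<Rightarrow> 'a fock_vec) \<Rightarrow> ('a fock_vec \<Rightarrow> 'a fock_vec)"
  assumes P: "stochastic P" and iso: "alg_iso Q P \<phi>"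
begin

section \<open>The isomorphism and its coefficient functionals\<close>

lemma phi_in: "a \<in> tensor_alg Q \<Longrightarrow> \<phi> a \<in> tensor_alg P"
  using iso by (auto simp: alg_iso_def bij_betw_def)

lemma phi_bops: "a \<in> tensor_alg Q \<Longrightarrow> \<phi> a \<in> bops P"
  by (intro phi_in tensor_alg_bops)

lemma phi_surj:
  assumes "y \<in> tensor_alg P"
  shows "\<exists>b\<in>tensor_alg Q. \<phi> b = y"
proof -
  have "y \<in> \<phi> ` tensor_alg Q" using iso assms by (simp add: alg_iso_def bij_betw_def)
  then obtain b where "y = \<phi> b" "b \<in> tensor_alg Q" by (rule imageE)
  then show ?thesis by (intro bexI[of _ b]) simp_all
qed

lemma phi_inj: "a \<in> tensor_alg Q \<Longrightarrow> b \<in> tensor_alg Q \<Longrightarrow> \<phi> a = \<phi> b \<Longrightarrow> a = b"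
  using iso by (auto simp: alg_iso_def bij_betw_def inj_on_def)

lemma phi_add: "a \<in> tensor_alg Q \<Longrightarrow> b \<in> tensor_alg Q \<Longrightarrow> \<phi> (a + b) = \<phi> a + \<phi> b"
  using iso by (simp add: alg_iso_def plus_fun_def)

lemma phi_scale: "a \<in> tensor_alg Q \<Longrightarrow> \<phi> (oscale c a) = oscale c (\<phi> a)"
  using iso by (simp add: alg_iso_def oscale_def fscale_def)

lemma phi_comp: "a \<in> tensor_alg Q \<Longrightarrow> b \<in> tensor_alg Q \<Longrightarrow> \<phi> (a \<circ> b) = \<phi> a \<circ> \<phi> b"
  using iso by (simp add: alg_iso_def)

lemma phi_0: "\<phi> 0 = 0"
proof -
  have *: "oscale 0 T = 0" for T :: "'a fock_vec \<Rightarrow> 'a fock_vec" by (simp add: fun_eq_iff)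
  show ?thesis using phi_scale[OF tensor_alg_0, of 0] by (simp only: *)
qed

lemma phi_comp_funpow: "a \<in> tensor_alg Q \<Longrightarrow> b \<in> tensor_alg Q \<Longrightarrow> \<phi> (a \<circ> (b ^^ n)) = \<phi> a \<circ> (\<phi> b ^^ n)"
proof (induction n arbitrary: a)
  case (Suc n)
  then show ?case unfolding comp_funpow_Suc
    by (simp only: Suc.IH[OF tensor_alg_comp[OF Suc.prems] Suc.prems(2)] phi_comp)
qed simp

definition cf :: "nat \<Rightarrow> 'a \<Rightarrow> 'a \<Rightarrow> ('a fock_vec \<Rightarrow> 'a fock_vec) \<Rightarrow> real" where
  "cf d i k a = cmod (coef (\<phi> a) d i k)"

lemma cf_scale: "a \<in> tensor_alg Q \<Longrightarrow> cf d i k (oscale c a) = cmod c * cf d i k a"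
  by (simp add: cf_def phi_scale coef_scale norm_mult)

lemma cf_add_ge: "a \<in> tensor_alg Q \<Longrightarrow> b \<in> tensor_alg Q \<Longrightarrow> cf d i k a - cf d i k b \<le> cf d i k (a + b)"
  using norm_diff_ineq[of "coef (\<phi> a) d i k" "coef (\<phi> b) d i k"]
  by (simp add: cf_def phi_add coef_add)

lemma cf_add_ge': "a \<in> tensor_alg Q \<Longrightarrow> b \<in> tensor_alg Q \<Longrightarrow> cf d i k b - cf d i k a \<le> cf d i k (a + b)"
  using cf_add_ge[of b a] by (simp add: add.commute)

lemma cf_le_op_norm: "a \<in> tensor_alg Q \<Longrightarrow> cf d i k a \<le> op_norm P (\<phi> a)"
  unfolding cf_def by (intro cmod_coef_le phi_bops)

section \<open>Bad states are finite in number, spread along edges and avoid cycles\<close>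

definition bad :: "'a set" where
  "bad = {k. \<exists>d i. \<not> dominated Q (cf d i k)}"

text \<open>The n-th functional does not change under right multiplication by b n, the preimage of
  the vertex projection at \<open>\<kappa> n\<close>, while b n annihilates all later terms from the
  right. The tail thus costs nothing at the n-th functional.\<close>

lemma finite_bad: "finite bad"
proof (rule ccontr)
  assume "infinite bad"
  then obtain \<kappa> :: "nat \<Rightarrow> 'a" where \<kappa>: "inj \<kappa>" "range \<kappa> \<subseteq> bad"
    by (meson infinite_countable_subset)
  then have "\<forall>n. \<exists>d i. \<not> dominated Q (cf d i (\<kappa> n))" unfolding bad_def by blast
  then obtain d i where und: "\<And>n. \<not> dominated Q (cf (d n) (i n) (\<kappa> n))" by metis
  have "\<forall>n. \<exists>b. b \<in> tensor_alg Q \<and> \<phi> b = vproj P (\<kappa> n)"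
    using phi_surj[OF vproj_tensor_alg] unfolding Bex_def by (rule allI)
  from choice[OF this] obtain b where b: "\<And>n. b n \<in> tensor_alg Q" "\<And>n. \<phi> (b n) = vproj P (\<kappa> n)" by auto
  \<comment> \<open>Orthogonality of the vertex projections is pulled back by injectivity of
    \<phi>.\<close>
  have orth: "b k \<circ> b n = 0" if "k \<noteq> n" for k n
  proof (rule phi_inj[OF tensor_alg_comp[OF b(1) b(1)] tensor_alg_0])
    show "\<phi> (b k \<circ> b n) = \<phi> 0"
      using vproj_orth[of "\<kappa> k" "\<kappa> n" P] that \<kappa>(1)
      by (simp only: phi_comp[OF b(1) b(1)] b(2) phi_0) (simp add: inj_eq)
  qed
  have coef_b: "coef (\<phi> (a \<circ> b n)) (d n) (i n) (\<kappa> n) = coef (\<phi> a) (d n) (i n) (\<kappa> n)" if "a \<in> tensor_alg Q" for a n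
    unfolding phi_comp[OF that b(1)] b(2) by (rule coef_vproj[OF phi_bops[OF that]])
  \<comment> \<open>The weight makes a n \<circ> b n of norm at most (1/4)^n; the added 1 avoids
    division by zero.\<close>
  define w where "w n = (1/4)^n / (1 + op_norm Q (b n))" for n
  note bn = op_norm_tensor_nonneg[OF b(1)]
  have w: "0 < w n" for n using bn[of n] by (simp add: w_def)
  have "\<exists>x\<in>tensor_alg Q. \<forall>n. real n - 0 \<le> cf (d n) (i n) (\<kappa> n) x"
  proof (rule gliding_hump[where D = "\<lambda>n. {a \<in> tensor_alg Q. op_norm Q a \<le> w n}" and M = "\<lambda>n a. a \<circ> b n"])
    fix n y assume y: "y \<in> tensor_alg Q"
    \<comment> \<open>The influence of earlier terms is compensated by aiming higher, by the value
      at y.\<close>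
    obtain a where a: "a \<in> tensor_alg Q" "op_norm Q a \<le> w n" "real n + cf (d n) (i n) (\<kappa> n) y \<le> cf (d n) (i n) (\<kappa> n) a"
      using undominated_pick[OF und cf_scale w] by blast
    have "cf (d n) (i n) (\<kappa> n) (a \<circ> b n) = cf (d n) (i n) (\<kappa> n) a"
      using coef_b[OF a(1)] by (simp add: cf_def)
    then have "real n \<le> cf (d n) (i n) (\<kappa> n) (y + (a \<circ> b n))"
      using cf_add_ge'[OF y tensor_alg_comp[OF a(1) b(1)], of "d n" "i n" "\<kappa> n" n] a(3) by linarith
    with a show "\<exists>a\<in>{a \<in> tensor_alg Q. op_norm Q a \<le> w n}. real n \<le> cf (d n) (i n) (\<kappa> n) (y + (a \<circ> b n))"
      by blast
  next
    fix a assume a: "\<And>n. a n \<in> {a \<in> tensor_alg Q. op_norm Q a \<le> w n}"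
    define u where "u n = a n \<circ> b n" for n
    have u: "u n \<in> tensor_alg Q" for n using a b(1) by (auto simp: u_def intro: tensor_alg_comp)
    have u_le: "op_norm Q (u n) \<le> (1/4)^n" for n
    proof -
      have "op_norm Q (u n) \<le> op_norm Q (a n) * op_norm Q (b n)"
        unfolding u_def using a[of n] b(1)[of n] by (auto intro: op_norm_comp tensor_alg_bops)
      also have "\<dots> \<le> w n * (1 + op_norm Q (b n))"
        using a[of n] bn[of n] w[of n] by (intro mult_mono) auto
      also have "\<dots> = (1/4)^n" using bn[of n] by (simp add: w_def)
      finally show ?thesis .
    qed
    obtain x where x: "x \<in> tensor_alg Q" "\<And>N. op_norm Q (x - sum u {..<N}) \<le> 4/3 * (1/4)^N"
      using tensor_alg_series[of u Q] u u_le by blast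
    have "cf (d n) (i n) (\<kappa> n) (sum u {..n}) - 0 \<le> cf (d n) (i n) (\<kappa> n) x" for n
    proof -
      define s t where "s = sum u {..n}" and "t = x - s"
      have s: "s \<in> tensor_alg Q" unfolding s_def by (intro tensor_alg_sum u)
      have t: "t \<in> tensor_alg Q" unfolding t_def by (rule tensor_alg_diff[OF x(1) s])
      \<comment> \<open>Up to an error of norm tending to 0, t is a finite sum of terms a k \<circ>
        b k with k > n, each annihilated by b n. Hence \<phi> (t \<circ> b n) = 0 without any
        continuity of \<phi>.\<close>
      have "t \<circ> b n = 0"
      proof (rule eq_0_if_geometric[of _ Q "Suc n"])
        show "t \<circ> b n \<in> bops Q" by (intro tensor_alg_bops tensor_alg_comp t b(1))
        fix N assume N: "Suc n \<le> N"
        have "(sum u {..<N} - s) \<circ> b n = 0"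
        proof -
          have "{..<N} = {..n} \<union> {n<..<N}" "{..n} \<inter> {n<..<N} = {}" using N by auto
          then have "sum u {..<N} = s + sum u {n<..<N}"
            unfolding s_def by (simp add: sum.union_disjoint)
          then have "(sum u {..<N} - s) \<circ> b n = (\<Sum>k\<in>{n<..<N}. u k \<circ> b n)"
            by (simp only: add_diff_cancel_left' comp_sum_left)
          also have "\<dots> = 0"
          proof (rule sum.neutral, rule ballI)
            fix k assume "k \<in> {n<..<N}"
            then have "u k \<circ> b n = a k \<circ> 0" using orth[of k n] by (simp only: u_def comp_assoc) simp
            also have "\<dots> = 0" by (rule comp_0_right[OF tensor_alg_bops]) (use a in blast)
            finally show "u k \<circ> b n = 0" .
          qed
          finally show ?thesis .
        qed
        moreover have "t = (x - sum u {..<N}) + (sum u {..<N} - s)" by (simp only: t_def diff_add_cancel add_diff_eq)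
        ultimately have "t \<circ> b n = (x - sum u {..<N}) \<circ> b n"
          by (simp only: comp_add_left add_0_right)
        then have "op_norm Q (t \<circ> b n) \<le> op_norm Q (x - sum u {..<N}) * op_norm Q (b n)"
          using x(1) u b(1) by (simp only:) (intro op_norm_comp tensor_alg_bops tensor_alg_diff tensor_alg_sum)
        also have "\<dots> \<le> (4/3 * (1/4)^N) * op_norm Q (b n)" by (intro mult_right_mono x(2) bn)
        finally show "op_norm Q (t \<circ> b n) \<le> 4/3 * op_norm Q (b n) * (1/4)^N" by (simp only: mult_ac)
      qed
      then have "cf (d n) (i n) (\<kappa> n) t = 0"
        using coef_b[OF t, of n] by (simp only: cf_def phi_0) (simp add: coef_def)
      moreover have "x = s + t" by (simp only: t_def add_diff_eq add_diff_cancel_left')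
      ultimately show ?thesis using cf_add_ge[OF s t, of "d n" "i n" "\<kappa> n"] by (simp add: s_def)
    qed
    with x(1) show "\<exists>x\<in>tensor_alg Q. \<forall>n. cf (d n) (i n) (\<kappa> n) (\<Sum>k\<le>n. a k \<circ> b k) - 0 \<le> cf (d n) (i n) (\<kappa> n) x"
      unfolding u_def by blast
  qed (use b(1) in \<open>auto intro: tensor_alg_0 tensor_alg_add tensor_alg_comp\<close>)
  then obtain x where "x \<in> tensor_alg Q" "\<And>n. real n \<le> cf (d n) (i n) (\<kappa> n) x" by auto
  then have "real n \<le> op_norm P (\<phi> x)" for n
    using cf_le_op_norm order_trans by blast
  moreover obtain n where "op_norm P (\<phi> x) < real n" using reals_Archimedean2 by blast
  ultimately show False by (meson not_le)
qed


text \<open>Let b be the preimage of the edge shift. Up to a positive factor, the functional at k is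
  one at l composed with a \<mapsto> a \<circ> b. That map is bounded, so a good l would make k
  good.\<close>

lemma bad_successor:
  assumes k: "k \<in> bad" and kl: "P k l \<noteq> 0"
  shows "l \<in> bad"
proof (rule ccontr)
  assume "l \<notin> bad"
  obtain d i where und: "\<not> dominated Q (cf d i k)" using k by (auto simp: bad_def)
  have m1: "mpow P 1 k l \<noteq> 0" using kl by (simp only: mpow_1[OF P] not_False_eq_True)
  obtain b where b: "b \<in> tensor_alg Q" "\<phi> b = ushift P 1 k l"
    using phi_surj[OF ushift_tensor_alg[OF P order_refl m1]] by (rule bexE) (rule that)
  \<comment> \<open>Where \<open>mpow P d i k\<close> is 0 the functional vanishes identically. An
    unbounded one therefore has positive weight, which makes \<gamma> positive.\<close>
  have md: "mpow P d i k \<noteq> 0"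
  proof
    assume "mpow P d i k = 0"
    then have "cf d i k a = 0" if "a \<in> tensor_alg Q" for a
      using coef_eq_0[OF phi_bops[OF that]] by (simp add: cf_def)
    then have "dominated Q (cf d i k)" by (intro dominated_0) simp
    with und show False ..
  qed
  define \<gamma> where "\<gamma> = sqrt (mpow P d i k * mpow P 1 k l / mpow P (d + 1) i l)"
  have \<gamma>: "0 < \<gamma>" unfolding \<gamma>_def by (rule rcreate_coeff_pos[OF P md m1])
  have eq: "cf (d + 1) i l (a \<circ> b) = \<gamma> * cf d i k a" if a: "a \<in> tensor_alg Q" for a
  proof -
    have "coef (\<phi> a \<circ> ushift P 1 k l) (d + 1) i l = complex_of_real \<gamma> * coef (\<phi> a) d i k"
      unfolding coef_ushift[OF P phi_in[OF a] m1] \<gamma>_def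
      by (simp only: le_add2 if_True add_diff_cancel_right')
    then show ?thesis
      using \<gamma> by (simp only: cf_def phi_comp[OF a b(1)] b(2) norm_mult norm_of_real abs_of_pos)
  qed
  have "dominated Q (cf (d + 1) i l)" using \<open>l \<notin> bad\<close> by (auto simp: bad_def)
  then obtain C where C: "0 \<le> C" "\<And>a. a \<in> tensor_alg Q \<Longrightarrow> cf (d + 1) i l a \<le> C * op_norm Q a"
    by (rule dominatedE) (rule that, blast+)
  have "cf d i k a \<le> (C * op_norm Q b / \<gamma>) * op_norm Q a" if a: "a \<in> tensor_alg Q" for a
  proof -
    have "\<gamma> * cf d i k a \<le> C * op_norm Q (a \<circ> b)"
      using C(2)[OF tensor_alg_comp[OF a b(1)]] eq[OF a] by simp
    also have "\<dots> \<le> C * (op_norm Q a * op_norm Q b)"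
      by (intro mult_left_mono op_norm_comp tensor_alg_bops a b(1) C(1))
    finally show ?thesis using \<gamma> by (simp add: field_simps)
  qed
  then have "dominated Q (cf d i k)" by (rule dominatedI)
  with und show False ..
qed

text \<open>Each shift contributes one weight of \<open>rcreate\<close>, and these do not depend on
  T. Positivity of \<Gamma> allows dividing by it when the humps are chosen.\<close>

lemma coef_comp_ushift_funpow:
  assumes p: "1 \<le> p" and r: "mpow P p r r \<noteq> 0"
  shows "\<exists>\<Gamma>>0. \<forall>T\<in>tensor_alg P. coef (T \<circ> (ushift P p r r ^^ n)) (e + n * p) i r = complex_of_real \<Gamma> * coef T e i r"
proof (induction n arbitrary: e)
  case 0
  show ?case by (auto intro!: exI[of _ 1])
next
  case (Suc n)
  let ?A = "ushift P p r r"
  note A = ushift_tensor_alg[OF P p r]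
  obtain \<Gamma> where \<Gamma>: "\<Gamma> > 0"
    "\<And>T. T \<in> tensor_alg P \<Longrightarrow> coef (T \<circ> (?A ^^ n)) (e + p + n * p) i r = complex_of_real \<Gamma> * coef T (e + p) i r"
    using Suc.IH[of "e + p"] by blast
  define \<gamma> where "\<gamma> = sqrt (mpow P e i r * mpow P p r r / mpow P (e + p) i r)"
  have \<gamma>: "coef (T \<circ> ?A) (e + p) i r = complex_of_real \<gamma> * coef T e i r" if "T \<in> tensor_alg P" for T
    using coef_ushift[OF P that r, of "e + p" i] by (simp add: \<gamma>_def)
  have step: "coef (T \<circ> (?A ^^ Suc n)) (e + Suc n * p) i r = complex_of_real (\<Gamma> * \<gamma>) * coef T e i r" if "T \<in> tensor_alg P" for T
    unfolding comp_funpow_Suc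
    using \<Gamma>(2)[OF tensor_alg_comp[OF that A]] \<gamma>[OF that] by (simp add: add.assoc)
  show ?case
  proof (cases "mpow P e i r = 0")
    case True
    \<comment> \<open>Both sides of the claim are 0 in this case, so any positive factor serves; 1
      is taken.\<close>
    then have "coef T e i r = 0" if "T \<in> tensor_alg P" for T
      by (rule coef_eq_0[OF tensor_alg_bops[OF that]])
    with step have "coef (T \<circ> (?A ^^ Suc n)) (e + Suc n * p) i r = complex_of_real 1 * coef T e i r" if "T \<in> tensor_alg P" for T
      using that by (simp only: mult_zero_right)
    then show ?thesis using zero_less_one by blast
  next
    case False
    then have "0 < \<gamma>" unfolding \<gamma>_def by (intro rcreate_coeff_pos[OF P] r)
    with \<Gamma>(1) have "0 < \<Gamma> * \<gamma>" by simp
    with step show ?thesis by blast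
  qed
qed

text \<open>At the n-th functional, the n-th term shows the unbounded functional of degree d,
  whereas every later term carries at least one more factor b, and this factor makes the functional
  bounded by minimality of d.\<close>

lemma recurrent_not_bad:
  assumes p: "1 \<le> p" and r: "mpow P p r r \<noteq> 0"
  shows "r \<notin> bad"
proof
  assume "r \<in> bad"
  \<comment> \<open>The row is fixed first: right multiplication by shifts changes the degree and
    the source, never the row, so minimality of d within one row suffices.\<close>
  then obtain i where "\<exists>d. \<not> dominated Q (cf d i r)" by (auto simp: bad_def)
  define d where "d = (LEAST d. \<not> dominated Q (cf d i r))"
  have und: "\<not> dominated Q (cf d i r)"
    unfolding d_def by (rule LeastI_ex) fact
  have dom: "dominated Q (cf e i r)" if "e < d" for e
    using not_less_Least[of e "\<lambda>d. \<not> dominated Q (cf d i r)"] that by (simp add: d_def)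
  let ?A = "ushift P p r r"
  note A = ushift_tensor_alg[OF P p r]
  obtain b where b: "b \<in> tensor_alg Q" "\<phi> b = ?A" using phi_surj[OF A] by (rule bexE) (rule that)
  have "\<forall>n. \<exists>\<Gamma>>0. \<forall>T\<in>tensor_alg P. coef (T \<circ> (?A ^^ n)) (d + n * p) i r = complex_of_real \<Gamma> * coef T d i r"
    using coef_comp_ushift_funpow[OF p r] by blast
  then obtain \<Gamma> where \<Gamma>: "\<And>n. \<Gamma> n > 0"
    "\<And>n T. T \<in> tensor_alg P \<Longrightarrow> coef (T \<circ> (?A ^^ n)) (d + n * p) i r = complex_of_real (\<Gamma> n) * coef T d i r"
    by metis
  have cf_pow: "cf (d + n * p) i r (a \<circ> (b ^^ n)) = \<Gamma> n * cf d i r a" if a: "a \<in> tensor_alg Q" for a n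
    using \<Gamma>(2)[OF phi_in[OF a], of n] \<Gamma>(1)[of n]
    by (simp add: cf_def phi_comp_funpow[OF a b(1)] b(2) norm_mult)
  \<comment> \<open>One factor b lowers the degree that is read off a by p \<ge> 1: the functional
    of degree d - p is bounded by minimality, and for p > d the value is 0.\<close>
  have "dominated Q (\<lambda>a. cf d i r (a \<circ> b))"
  proof (cases "p \<le> d")
    case True
    define \<gamma> where "\<gamma> = sqrt (mpow P (d - p) i r * mpow P p r r / mpow P d i r)"
    have \<gamma>: "0 \<le> \<gamma>" using mpow_nonneg[OF P] by (simp add: \<gamma>_def)
    have le: "cf d i r (a \<circ> b) \<le> \<gamma> * cf (d - p) i r a" if a: "a \<in> tensor_alg Q" for a
      using coef_ushift[OF P phi_in[OF a] r, of d i] True \<gamma>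
      by (simp add: cf_def phi_comp[OF a b(1)] b(2) norm_mult \<gamma>_def[symmetric])
    have "dominated Q (cf (d - p) i r)" using True p by (intro dom) simp
    then show ?thesis using \<gamma> le by (rule dominated_scale)
  next
    case False
    have "cf d i r (a \<circ> b) \<le> 0" if a: "a \<in> tensor_alg Q" for a
      using coef_ushift[OF P phi_in[OF a] r, of d i] False
      by (simp add: cf_def phi_comp[OF a b(1)] b(2))
    then show ?thesis by (rule dominated_0)
  qed
  then obtain K where K: "0 \<le> K" "\<And>a. a \<in> tensor_alg Q \<Longrightarrow> cf d i r (a \<circ> b) \<le> K * op_norm Q a"
    by (rule dominatedE) (rule that, blast+)
  \<comment> \<open>Dividing by a power of 1 + \<open>op_norm Q b\<close> keeps a (m + n) small
    enough to be paired with \<open>b ^^ n\<close> for any m: the tail must converge at the same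
    rate after a common power of b has been removed.\<close>
  define w where "w n = (1/4)^n / (1 + op_norm Q b)^n" for n :: nat
  note bn = op_norm_tensor_nonneg[OF b(1)]
  have w: "0 < w n" for n using bn by (simp add: w_def)
  have w_mult: "w (m + n) * op_norm Q b ^ n \<le> (1/4)^n" for m n
  proof -
    have "w (m + n) * op_norm Q b ^ n \<le> w (m + n) * (1 + op_norm Q b)^(m + n)"
    proof (rule mult_left_mono)
      have "op_norm Q b ^ n \<le> (1 + op_norm Q b)^n" using bn by (intro power_mono) auto
      also have "\<dots> \<le> (1 + op_norm Q b)^(m + n)" using bn by (intro power_increasing) auto
      finally show "op_norm Q b ^ n \<le> (1 + op_norm Q b)^(m + n)" .
    qed (use w in \<open>simp add: less_imp_le\<close>)
    also have "\<dots> = (1/4)^(m + n)" using bn by (simp add: w_def)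
    also have "\<dots> \<le> (1/4)^n" by (rule power_decreasing) auto
    finally show ?thesis .
  qed
  \<comment> \<open>A bound for what all later terms contribute: \<Gamma> n comes from n factors b,
    K from one further factor, and 4/3 from the norm of the quotient y. It depends on none of the
    choices, so \<open>pick\<close> can aim at n + C n.\<close>
  define C where "C n = \<Gamma> n * (K * (4/3))" for n
  have "\<exists>x\<in>tensor_alg Q. \<forall>n. (real n + C n) - C n \<le> cf (d + n * p) i r x"
  proof (rule gliding_hump[where D = "\<lambda>n. {a \<in> tensor_alg Q. op_norm Q a \<le> w n}" and M = "\<lambda>n a. a \<circ> (b ^^ n)"])
    fix n y assume y: "y \<in> tensor_alg Q"
    obtain a where a: "a \<in> tensor_alg Q" "op_norm Q a \<le> w n"
      "(real n + C n + cf (d + n * p) i r y) / \<Gamma> n \<le> cf d i r a"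
      using undominated_pick[OF und cf_scale w] by blast
    from a(3) have "real n + C n + cf (d + n * p) i r y \<le> \<Gamma> n * cf d i r a"
      using \<Gamma>(1)[of n] by (simp add: divide_le_eq mult.commute)
    then have "real n + C n \<le> cf (d + n * p) i r (y + (a \<circ> (b ^^ n)))"
      using cf_add_ge'[OF y tensor_alg_comp_funpow[OF a(1) b(1)], of "d + n * p" i r n] cf_pow[OF a(1), of n] by linarith
    with a show "\<exists>a\<in>{a \<in> tensor_alg Q. op_norm Q a \<le> w n}. real n + C n \<le> cf (d + n * p) i r (y + (a \<circ> (b ^^ n)))"
      by blast
  next
    fix a assume a': "\<And>n. a n \<in> {a \<in> tensor_alg Q. op_norm Q a \<le> w n}"
    then have a: "\<And>n. a n \<in> tensor_alg Q" "\<And>n. op_norm Q (a n) \<le> w n" by auto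
    \<comment> \<open>Applied with m = 0 to the series itself and with m = Suc n to the quotient of
      its tail.\<close>
    have le: "op_norm Q (a (m + n) \<circ> (b ^^ n)) \<le> (1/4)^n" for m n
    proof -
      have "op_norm Q (a (m + n) \<circ> (b ^^ n)) \<le> op_norm Q (a (m + n)) * op_norm Q b ^ n"
        by (rule op_norm_comp_funpow[OF a(1) b(1)])
      also have "\<dots> \<le> w (m + n) * op_norm Q b ^ n" by (intro mult_right_mono a(2) zero_le_power bn)
      also have "\<dots> \<le> (1/4)^n" by (rule w_mult)
      finally show ?thesis .
    qed
    define u where "u n = a n \<circ> (b ^^ n)" for n
    have u: "u n \<in> tensor_alg Q" for n unfolding u_def by (rule tensor_alg_comp_funpow[OF a(1) b(1)])
    obtain x where x: "x \<in> tensor_alg Q" "\<And>N. op_norm Q (x - sum u {..<N}) \<le> 4/3 * (1/4)^N"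
      using tensor_alg_series[of u Q] u le[of 0] by (auto simp: u_def)
    have "cf (d + n * p) i r (sum u {..n}) - C n \<le> cf (d + n * p) i r x" for n
    proof -
      define s t where "s = sum u {..n}" and "t = x - s"
      have s: "s \<in> tensor_alg Q" unfolding s_def by (intro tensor_alg_sum u)
      have t: "t \<in> tensor_alg Q" unfolding t_def by (rule tensor_alg_diff[OF x(1) s])
      \<comment> \<open>The terms beyond n with \<open>b ^^ Suc n\<close> cancelled on the right;
        their sum is the quotient y.\<close>
      define v where "v m = a (Suc n + m) \<circ> (b ^^ m)" for m
      have v: "v m \<in> tensor_alg Q" for m unfolding v_def by (rule tensor_alg_comp_funpow[OF a(1) b(1)])
      obtain y where y: "y \<in> tensor_alg Q" "\<And>N. op_norm Q (y - sum v {..<N}) \<le> 4/3 * (1/4)^N"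
        using tensor_alg_series[of v Q] v le[of "Suc n"] unfolding v_def by blast
      let ?B = "b ^^ Suc n"
      have yB: "y \<circ> ?B \<in> tensor_alg Q" by (rule tensor_alg_comp_funpow[OF y(1) b(1)])
      \<comment> \<open>The identity is exact for partial sums, and right multiplication by the
        fixed power \<open>?B\<close> is bounded, so the difference is at most a constant times
        (1/4)^N for every N.\<close>
      have "t - (y \<circ> ?B) = 0"
      proof (rule eq_0_if_geometric[of _ Q 0])
        show "t - (y \<circ> ?B) \<in> bops Q" by (intro tensor_alg_bops tensor_alg_diff t yB)
        fix N
        define x' y' where "x' = x - sum u {..<Suc n + N}" and "y' = y - sum v {..<N}"
        have x': "x' \<in> tensor_alg Q" unfolding x'_def by (intro tensor_alg_diff x(1) tensor_alg_sum u)
        have y': "y' \<in> tensor_alg Q" unfolding y'_def by (intro tensor_alg_diff y(1) tensor_alg_sum v)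
        have "sum u {..<Suc n + N} = s + (sum v {..<N} \<circ> ?B)"
        proof -
          have "v m \<circ> ?B = u (Suc n + m)" for m
            unfolding u_def v_def by (simp only: comp_assoc funpow_add[symmetric] add.commute)
          then have "sum v {..<N} \<circ> ?B = (\<Sum>m<N. u (Suc n + m))" by (simp only: comp_sum_left)
          moreover have "sum u {..<Suc n + N} = s + (\<Sum>m<N. u (Suc n + m))"
            unfolding s_def lessThan_Suc_atMost[symmetric]
            by (induction N) (simp_all only: add_0_right lessThan_0 sum.empty add_Suc_right sum.lessThan_Suc add.assoc)
          ultimately show ?thesis by simp
        qed
        then have "t - (y \<circ> ?B) = x' - (y' \<circ> ?B)"
          unfolding t_def x'_def y'_def comp_diff_left by (simp only: algebra_simps)
        then have "op_norm Q (t - (y \<circ> ?B)) \<le> op_norm Q x' + op_norm Q (y' \<circ> ?B)"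
          by (simp only:) (intro op_norm_diff tensor_alg_bops x' tensor_alg_comp_funpow[OF y' b(1)])
        also have "\<dots> \<le> 4/3 * (1/4)^N + (4/3 * (1/4)^N) * op_norm Q b ^ Suc n"
        proof (rule add_mono)
          have "op_norm Q x' \<le> 4/3 * (1/4)^(Suc n + N)" unfolding x'_def by (rule x(2))
          also have "\<dots> \<le> 4/3 * (1/4)^N" by (intro mult_left_mono power_decreasing) auto
          finally show "op_norm Q x' \<le> 4/3 * (1/4)^N" .
          have "op_norm Q (y' \<circ> ?B) \<le> op_norm Q y' * op_norm Q b ^ Suc n"
            by (rule op_norm_comp_funpow[OF y' b(1)])
          also have "\<dots> \<le> (4/3 * (1/4)^N) * op_norm Q b ^ Suc n"
            unfolding y'_def by (intro mult_right_mono y(2) zero_le_power bn)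
          finally show "op_norm Q (y' \<circ> ?B) \<le> (4/3 * (1/4)^N) * op_norm Q b ^ Suc n" .
        qed
        also have "\<dots> = (4/3 + 4/3 * op_norm Q b ^ Suc n) * (1/4)^N" by (simp only: algebra_simps)
        finally show "op_norm Q (t - (y \<circ> ?B)) \<le> (4/3 + 4/3 * op_norm Q b ^ Suc n) * (1/4)^N" .
      qed
      \<comment> \<open>One of the n + 1 factors stays with y: the remaining \<open>b ^^ n\<close>
        turns the functional into \<Gamma> n times the one of degree d, and K controls the latter at
        y \<circ> b.\<close>
      then have ty: "t = (y \<circ> b) \<circ> (b ^^ n)" by (simp only: right_minus_eq comp_funpow_Suc)
      have "op_norm Q y \<le> 4/3" using y(2)[of 0] by (simp only: lessThan_0 sum.empty diff_zero power_0 mult_1_right)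
      then have "cf d i r (y \<circ> b) \<le> K * (4/3)"
        using K(2)[OF y(1)] mult_left_mono[OF _ K(1)] order_trans by blast
      then have "cf (d + n * p) i r t \<le> C n"
        using cf_pow[OF tensor_alg_comp[OF y(1) b(1)], of n] \<Gamma>(1)[of n]
        by (simp only: ty C_def) (simp add: mult_left_mono)
      moreover have "x = s + t" by (simp only: t_def add_diff_eq add_diff_cancel_left')
      ultimately show ?thesis using cf_add_ge[OF s t, of "d + n * p" i r] by (simp add: s_def)
    qed
    with x(1) show "\<exists>x\<in>tensor_alg Q. \<forall>n. cf (d + n * p) i r (\<Sum>k\<le>n. a k \<circ> (b ^^ k)) - C n \<le> cf (d + n * p) i r x"
      unfolding u_def by blast
  qed (use b(1) in \<open>auto intro: tensor_alg_0 tensor_alg_add tensor_alg_comp_funpow\<close>)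
  then obtain x where "x \<in> tensor_alg Q" "\<And>n. real n \<le> cf (d + n * p) i r x" by auto
  then have "real n \<le> op_norm P (\<phi> x)" for n
    using cf_le_op_norm order_trans by blast
  moreover obtain n where "op_norm P (\<phi> x) < real n" using reals_Archimedean2 by blast
  ultimately show False by (meson not_le)
qed

text \<open>As rows sum to 1, each state has a successor. A walk along chosen successors stays among
  finitely many bad states, hence repeats, and the repetition is a closed walk of positive weight
  based at a bad state.\<close>

lemma bad_empty: "bad = {}"
proof (rule ccontr)
  assume "bad \<noteq> {}"
  then obtain k0 where k0: "k0 \<in> bad" by blast
  have "\<exists>l. P k l \<noteq> 0" for k
  proof (rule ccontr)
    assume "\<not> ?thesis"
    then have "(P k has_sum 0) UNIV" by (intro has_sum_0) auto
    moreover have "(P k has_sum 1) UNIV" using P by (simp add: stochastic_def)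
    ultimately show False using has_sum_unique zero_neq_one by blast
  qed
  then obtain s where s: "\<And>k. P k (s k) \<noteq> 0" by metis
  define f where "f n = (s ^^ n) k0" for n
  have f_Suc: "f (Suc n) = s (f n)" for n by (simp add: f_def)
  have f_bad: "f n \<in> bad" for n
  proof (induction n)
    case (Suc n)
    then show ?case unfolding f_Suc by (rule bad_successor[OF _ s])
  qed (simp add: f_def k0)
  have "\<not> inj f"
  proof
    assume "inj f"
    then have "finite (UNIV :: nat set)"
      using finite_bad f_bad by (meson finite_imageD finite_subset image_subsetI)
    then show False by simp
  qed
  then obtain m n where mn: "m < n" "f m = f n" unfolding inj_def by (metis linorder_neqE_nat)
  have pos: "0 < mpow P q (f m) (f (m + q))" for q
  proof (induction q)
    case (Suc q)
    have "0 \<le> P k l" for k l using P by (simp add: stochastic_def)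
    then have "0 < P (f (m + q)) (s (f (m + q)))" using s by (simp add: order_less_le)
    then have "0 < mpow P q (f m) (f (m + q)) * mpow P 1 (f (m + q)) (f (m + Suc q))"
      using Suc.IH unfolding mpow_1[OF P] by (simp add: f_Suc)
    also have "\<dots> \<le> mpow P (q + 1) (f m) (f (m + Suc q))" by (rule mpow_mult_le[OF P])
    finally show ?case by (simp only: Suc_eq_plus1)
  qed simp
  have "mpow P (n - m) (f m) (f m) \<noteq> 0" using pos[of "n - m"] mn by simp
  then have "f m \<notin> bad" using mn(1) by (intro recurrent_not_bad) auto
  with f_bad show False by blast
qed

lemma cf_dominated: "dominated Q (cf d i k)"
  using bad_empty by (auto simp: bad_def)

end

section \<open>From coefficients to the operator norm\<close>

text \<open>With G = \<open>UNIV\<close> this isolates one column; a finite G leaves a finite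
  combination of matrix units within it.\<close>

definition trunc :: "(nat \<times> 'a) set \<Rightarrow> 'a \<Rightarrow> 'a fock_vec \<Rightarrow> 'a fock_vec" where
  "trunc G j \<xi> = (\<lambda>n i j'. if j' = j \<and> (n, i) \<in> G then \<xi> n i j' else 0)"

lemma trunc_fbound:
  assumes "\<xi> \<in> fock P"
  shows "fbound (trunc G j \<xi>) (fnorm \<xi>)"
proof (rule fbound_sqI)
  fix j' and H :: "(nat \<times> 'a) set" assume H: "finite H"
  have "(\<Sum>(n, i)\<in>H. (cmod (trunc G j \<xi> n i j'))\<^sup>2) \<le> (\<Sum>(n, i)\<in>H. (cmod (\<xi> n i j'))\<^sup>2)"
    by (intro sum_mono) (auto simp: trunc_def)
  also have "\<dots> \<le> (fnorm \<xi>)\<^sup>2" by (rule sum_sq_le_fnorm[OF assms H])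
  finally show "(\<Sum>(n, i)\<in>H. (cmod (trunc G j \<xi> n i j'))\<^sup>2) \<le> (fnorm \<xi>)\<^sup>2" .
qed simp

lemma trunc_fock: "\<xi> \<in> fock P \<Longrightarrow> trunc G j \<xi> \<in> fock P"
  using trunc_fbound[of \<xi> P G j] by (auto simp: fock_iff trunc_def)

text \<open>The squares in column j have a finite supremum S over finite sets; a set that comes
  within \<epsilon>^2 of S leaves squares of total at most \<epsilon>^2 outside.\<close>

lemma trunc_approx:
  assumes x: "\<xi> \<in> fock P" and e: "0 < \<epsilon>"
  obtains G where "finite G" "fnorm (trunc UNIV j \<xi> - trunc G j \<xi>) \<le> \<epsilon>"
proof -
  define f where "f = (\<lambda>x. (cmod (\<xi> (fst x) (snd x) j))\<^sup>2)"
  define S where "S = (SUP G\<in>Collect finite. sum f G)"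
  have bdd: "bdd_above (sum f ` Collect finite)"
    using sum_sq_le_fnorm[OF x, of _ j] by (auto simp: bdd_above_def f_def case_prod_unfold)
  have up: "sum f G \<le> S" if "finite G" for G
    unfolding S_def using that by (intro cSUP_upper[OF _ bdd]) simp
  have "S - \<epsilon>\<^sup>2 < S" using e by simp
  then have "\<exists>G\<in>Collect finite. S - \<epsilon>\<^sup>2 < sum f G"
    unfolding S_def by (subst (asm) less_cSUP_iff[OF _ bdd]) auto
  then obtain G where G: "finite G" "S - \<epsilon>\<^sup>2 < sum f G" by blast
  have "fbound (trunc UNIV j \<xi> - trunc G j \<xi>) \<epsilon>"
  proof (rule fbound_sqI)
    fix j' and H :: "(nat \<times> 'a) set" assume H: "finite H"
    have "(\<Sum>(n, i)\<in>H. (cmod ((trunc UNIV j \<xi> - trunc G j \<xi>) n i j'))\<^sup>2) \<le> (\<Sum>x\<in>H. if x \<in> G then 0 else f x)"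
      by (intro sum_mono) (auto simp: trunc_def f_def)
    also have "\<dots> = sum f (H - G)"
      using H by (simp add: sum.If_cases Diff_eq)
    also have "\<dots> = sum f (H \<union> G) - sum f G"
      using sum.subset_diff[of G "H \<union> G" f] H G(1) by (simp add: Un_Diff)
    also have "\<dots> \<le> \<epsilon>\<^sup>2" using up[of "H \<union> G"] H G by simp
    finally show "(\<Sum>(n, i)\<in>H. (cmod ((trunc UNIV j \<xi> - trunc G j \<xi>) n i j'))\<^sup>2) \<le> \<epsilon>\<^sup>2" .
  qed (use e in simp)
  then show ?thesis using that[OF G(1)] fnorm_le by blast
qed

text \<open>Selecting a column is right creation in degree 0, hence commutes with the tensor
  algebra. Where \<open>mpow P n i j\<close> is 0 the weight is 0/0 = 0 instead of 1, but \<eta>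
  vanishes there.\<close>

lemma rcreate_0:
  assumes "\<eta> \<in> fock P"
  shows "rcreate P 0 j j \<eta> = trunc UNIV j \<eta>"
proof (intro ext)
  fix n i j'
  show "rcreate P 0 j j \<eta> n i j' = trunc UNIV j \<eta> n i j'"
    by (cases "mpow P n i j = 0") (auto simp: rcreate_def trunc_def fock_eq_0[OF _ assms])
qed

text \<open>Elements of the tensor algebra act column by column. This permits approximation inside a
  single column, where finite truncations converge in norm.\<close>

lemma tensor_alg_column:
  assumes "stochastic P" "T \<in> tensor_alg P" "\<xi> \<in> fock P"
  shows "T (trunc UNIV j \<xi>) n i j = T \<xi> n i j"
proof -
  have "T (trunc UNIV j \<xi>) = trunc UNIV j (T \<xi>)"
    using tensor_alg_rcreate[OF assms, of 0 j j]
    by (simp only: rcreate_0[OF assms(3)] rcreate_0[OF bops_fock[OF tensor_alg_bops[OF assms(2)]]])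
  then show ?thesis by (simp add: trunc_def)
qed

context
  fixes P Q :: "'a \<Rightarrow> 'a \<Rightarrow> real" and \<phi> :: "('a fock_vec \<Rightarrow> 'a fock_vec) \<Rightarrow> ('a fock_vec \<Rightarrow> 'a fock_vec)"
  assumes P: "stochastic P" and iso: "alg_iso Q P \<phi>"
begin

lemma ket_dominated:
  assumes "mpow P p k l \<noteq> 0"
  shows "dominated Q (\<lambda>a. cmod (\<phi> a (ket p k l) n i j))"
proof (cases "j = l \<and> p \<le> n")
  case True
  let ?c = "sqrt (mpow P (n - p) i k * mpow P p k l / mpow P n i l)"
  have c: "0 \<le> ?c" using mpow_nonneg[OF P] by simp
  have "cmod (\<phi> a (ket p k l) n i j) \<le> ?c * cf \<phi> (n - p) i k a" if "a \<in> tensor_alg Q" for a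
    unfolding tensor_alg_ket[OF P phi_in[OF P iso that] assms]
    using True c by (simp add: norm_mult cf_def[OF P iso])
  with cf_dominated[OF P iso] c show ?thesis by (rule dominated_scale)
next
  case False
  have "cmod (\<phi> a (ket p k l) n i j) \<le> 0" if "a \<in> tensor_alg Q" for a
    unfolding tensor_alg_ket[OF P phi_in[OF P iso that] assms]
    by (simp only: if_not_P[OF False] norm_zero order_refl)
  then show ?thesis by (rule dominated_0)
qed

text \<open>A finite truncation is a finite combination of matrix units, and each of them
  contributes a multiple of a single coefficient functional.\<close>

lemma trunc_dominated:
  assumes x: "\<xi> \<in> fock P" and G: "finite G"
  shows "dominated Q (\<lambda>a. cmod (\<phi> a (trunc G j' \<xi>) n i j))"
  using G
proof (induction G)
  case empty
  have "trunc {} j' \<xi> = 0" by (simp add: trunc_def fun_eq_iff)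
  then have "cmod (\<phi> a (trunc {} j' \<xi>) n i j) \<le> 0" if "a \<in> tensor_alg Q" for a
    using bops_app_0[OF phi_bops[OF P iso that]] by simp
  then show ?case by (rule dominated_0)
next
  case (insert x G)
  obtain p k where x_eq: "x = (p, k)" by (cases x)
  show ?case
  proof (cases "mpow P p k j' = 0")
    case True
    \<comment> \<open>The position lies outside the support of \<open>mpow P p\<close>: its matrix
      unit is not in the Fock space, but \<xi> vanishes there and nothing is added.\<close>
    then have "trunc (insert x G) j' \<xi> = trunc G j' \<xi>"
      using fock_eq_0[OF True x] by (auto simp: trunc_def fun_eq_iff x_eq)
    with insert.IH show ?thesis by simp
  next
    case False
    define c where "c = \<xi> p k j'"
    note kf = ket_fock[OF False]
    have eq: "trunc (insert x G) j' \<xi> = trunc G j' \<xi> + fscale c (ket p k j')"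
      using insert.hyps(2) by (auto simp: trunc_def ket_def fun_eq_iff x_eq c_def)
    have "dominated Q (\<lambda>a. cmod c * cmod (\<phi> a (ket p k j') n i j))"
      by (rule dominated_scale[OF ket_dominated[OF False]]) (rule norm_ge_zero, rule order_refl)
    with insert.IH show ?thesis
    proof (rule dominated_add)
      fix a assume "a \<in> tensor_alg Q"
      note b = phi_bops[OF P iso this]
      have "\<phi> a (trunc (insert x G) j' \<xi>) n i j = \<phi> a (trunc G j' \<xi>) n i j + c * \<phi> a (ket p k j') n i j"
        unfolding eq bops_add[OF b trunc_fock[OF x] fock_scale[OF kf]] bops_scale[OF b kf] by simp
      then show "cmod (\<phi> a (trunc (insert x G) j' \<xi>) n i j)
          \<le> cmod (\<phi> a (trunc G j' \<xi>) n i j) + cmod c * cmod (\<phi> a (ket p k j') n i j)"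
        using norm_triangle_ineq by (simp add: norm_mult[symmetric])
    qed
  qed
qed

text \<open>Uniform boundedness is applied to finite pieces of the norm of \<phi> a \<xi>; truncated
  columns then reach the whole unit ball.\<close>

lemma alg_iso_bounded: "\<exists>C. \<forall>T\<in>tensor_alg Q. op_norm P (\<phi> T) \<le> C * op_norm Q T"
proof -
  \<comment> \<open>Boundedness of the coordinates is built into \<Lambda>, so the premise on single
    functionals is immediate; that truncated vectors qualify is shown when they are used.\<close>
  define \<Lambda> where "\<Lambda> = {(\<xi>, j, G). \<xi> \<in> fock P \<and> fnorm \<xi> \<le> 1 \<and> finite (G :: (nat \<times> 'a) set)
    \<and> (\<forall>n i. dominated Q (\<lambda>a. cmod (\<phi> a \<xi> n i j)))}"
  define q where "q = (\<lambda>(\<xi>, j, G) a. L2_set (\<lambda>(n, i). cmod (\<phi> a \<xi> n i j)) G)"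
  have "\<exists>C. \<forall>\<alpha>\<in>\<Lambda>. \<forall>x\<in>tensor_alg Q. q \<alpha> x \<le> C * op_norm Q x"
  proof (rule uniform_boundedness)
    fix \<alpha> x y assume \<alpha>: "\<alpha> \<in> \<Lambda>" and x: "x \<in> tensor_alg Q" and y: "y \<in> tensor_alg Q"
    obtain \<xi> j G where a: "\<alpha> = (\<xi>, j, G)" by (cases \<alpha>)
    have "L2_set (\<lambda>(n, i). cmod (\<phi> (x + y) \<xi> n i j)) G
        \<le> L2_set (\<lambda>z. (case z of (n, i) \<Rightarrow> cmod (\<phi> x \<xi> n i j)) + (case z of (n, i) \<Rightarrow> cmod (\<phi> y \<xi> n i j))) G"
      unfolding phi_add[OF P iso x y] by (rule L2_set_mono) (auto simp: norm_triangle_ineq)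
    also have "\<dots> \<le> L2_set (\<lambda>(n, i). cmod (\<phi> x \<xi> n i j)) G + L2_set (\<lambda>(n, i). cmod (\<phi> y \<xi> n i j)) G"
      by (rule L2_set_triangle_ineq)
    finally show "q \<alpha> (x + y) \<le> q \<alpha> x + q \<alpha> y" by (simp add: q_def a)
  next
    fix \<alpha> x c assume \<alpha>: "\<alpha> \<in> \<Lambda>" and x: "x \<in> tensor_alg Q"
    obtain \<xi> j G where a: "\<alpha> = (\<xi>, j, G)" by (cases \<alpha>)
    have "L2_set (\<lambda>(n, i). cmod (\<phi> (oscale c x) \<xi> n i j)) G
        = L2_set (\<lambda>z. cmod c * (case z of (n, i) \<Rightarrow> cmod (\<phi> x \<xi> n i j))) G"
      unfolding phi_scale[OF P iso x] by (rule L2_set_cong) (auto simp: norm_mult)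
    then show "q \<alpha> (oscale c x) = cmod c * q \<alpha> x"
      by (simp add: q_def a L2_set_right_distrib)
  next
    fix \<alpha> assume \<alpha>: "\<alpha> \<in> \<Lambda>"
    obtain \<xi> j G where a: "\<alpha> = (\<xi>, j, G)" by (cases \<alpha>)
    have "dominated Q (\<lambda>x. \<Sum>z\<in>G. cmod (\<phi> x \<xi> (fst z) (snd z) j))"
      by (rule dominated_sum) (use \<alpha> in \<open>simp add: \<Lambda>_def a\<close>)
    then show "dominated Q (q \<alpha>)"
      by (rule dominated_scale[where c = 1])
        (auto simp: q_def a case_prod_unfold intro: L2_set_le_sum)
  next
    fix x assume x: "x \<in> tensor_alg Q"
    have "q \<alpha> x \<le> op_norm P (\<phi> x)" if \<alpha>: "\<alpha> \<in> \<Lambda>" for \<alpha>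
    proof -
      obtain \<xi> j G where a: "\<alpha> = (\<xi>, j, G)" by (cases \<alpha>)
      have \<xi>: "\<xi> \<in> fock P" "fnorm \<xi> \<le> 1" "finite G" using \<alpha> by (auto simp: \<Lambda>_def a)
      note b = phi_bops[OF P iso x]
      have "q \<alpha> x \<le> fnorm (\<phi> x \<xi>)"
        unfolding q_def a prod.case by (rule L2_set_le_fnorm[OF bops_fock[OF b] \<xi>(3)])
      also have "\<dots> \<le> op_norm P (\<phi> x) * fnorm \<xi>" by (rule fnorm_le_op_norm[OF b \<xi>(1)])
      also have "\<dots> \<le> op_norm P (\<phi> x)" by (rule mult_left_le[OF \<xi>(2) op_norm_nonneg[OF b]])
      finally show ?thesis .
    qed
    then show "\<exists>B. \<forall>\<alpha>\<in>\<Lambda>. q \<alpha> x \<le> B" by blast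
  qed
  then obtain C where C: "\<And>\<alpha> x. \<alpha> \<in> \<Lambda> \<Longrightarrow> x \<in> tensor_alg Q \<Longrightarrow> q \<alpha> x \<le> C * op_norm Q x" by blast
  have "op_norm P (\<phi> a) \<le> C * op_norm Q a" if a: "a \<in> tensor_alg Q" for a
  proof (rule op_norm_le, rule fnorm_le, unfold fbound_def, intro allI impI)
    fix \<xi> j and G :: "(nat \<times> 'a) set"
    assume \<xi>: "\<xi> \<in> fock P" "fnorm \<xi> \<le> 1" and G: "finite G"
    define T where "T = \<phi> a"
    have T: "T \<in> bops P" unfolding T_def by (rule phi_bops[OF P iso a])
    \<comment> \<open>The approximation error is measured with the norm of the one operator T, while
      C does not depend on T; letting \<epsilon> tend to 0 removes the error and leaves the uniform
      bound.\<close>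
    have le: "L2_set (\<lambda>(n, i). cmod (T \<xi> n i j)) G \<le> C * op_norm Q a + op_norm P T * \<epsilon>" if e: "0 < \<epsilon>" for \<epsilon>
    proof -
      obtain H where H: "finite H" "fnorm (trunc UNIV j \<xi> - trunc H j \<xi>) \<le> \<epsilon>"
        using trunc_approx[OF \<xi>(1) e] by blast
      let ?h = "trunc H j \<xi>" and ?d = "trunc UNIV j \<xi> - trunc H j \<xi>"
      have d: "?d \<in> fock P" by (intro fock_diff trunc_fock \<xi>)
      have "T \<xi> n i j = T ?h n i j + T ?d n i j" for n i
      proof -
        have "T \<xi> n i j = T (trunc UNIV j \<xi>) n i j"
          unfolding T_def using tensor_alg_column[OF P phi_in[OF P iso a] \<xi>(1)] by simp
        also have "trunc UNIV j \<xi> = ?h + ?d" by simp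
        finally show ?thesis unfolding bops_add[OF T trunc_fock[OF \<xi>(1)] d] by simp
      qed
      then have "L2_set (\<lambda>(n, i). cmod (T \<xi> n i j)) G
          \<le> L2_set (\<lambda>z. (case z of (n, i) \<Rightarrow> cmod (T ?h n i j)) + (case z of (n, i) \<Rightarrow> cmod (T ?d n i j))) G"
        by (intro L2_set_mono) (auto simp: norm_triangle_ineq)
      also have "\<dots> \<le> L2_set (\<lambda>(n, i). cmod (T ?h n i j)) G + L2_set (\<lambda>(n, i). cmod (T ?d n i j)) G"
        by (rule L2_set_triangle_ineq)
      also have "\<dots> \<le> C * op_norm Q a + op_norm P T * \<epsilon>"
      proof (rule add_mono)
        have "fnorm ?h \<le> 1" using fnorm_le[OF trunc_fbound[OF \<xi>(1)]] \<xi>(2) order_trans by blast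
        then have "(?h, j, G) \<in> \<Lambda>"
          using trunc_fock[OF \<xi>(1)] trunc_dominated[OF \<xi>(1) H(1)] G by (simp add: \<Lambda>_def)
        from C[OF this a] show "L2_set (\<lambda>(n, i). cmod (T ?h n i j)) G \<le> C * op_norm Q a"
          by (simp add: q_def T_def)
        have "L2_set (\<lambda>(n, i). cmod (T ?d n i j)) G \<le> fnorm (T ?d)"
          by (rule L2_set_le_fnorm[OF bops_fock[OF T] G])
        also have "\<dots> \<le> op_norm P T * fnorm ?d" by (rule fnorm_le_op_norm[OF T d])
        also have "\<dots> \<le> op_norm P T * \<epsilon>" by (intro mult_left_mono H(2) op_norm_nonneg[OF T])
        finally show "L2_set (\<lambda>(n, i). cmod (T ?d n i j)) G \<le> op_norm P T * \<epsilon>" .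
      qed
      finally show ?thesis .
    qed
    have "((\<lambda>\<epsilon>. C * op_norm Q a + op_norm P T * \<epsilon>) \<longlongrightarrow> C * op_norm Q a + op_norm P T * 0) (at_right 0)"
      by (intro tendsto_intros)
    then have "L2_set (\<lambda>(n, i). cmod (T \<xi> n i j)) G \<le> C * op_norm Q a + op_norm P T * 0"
      by (rule tendsto_lowerbound) (auto simp: eventually_at_right_field intro!: exI[of _ 1] le)
    then show "L2_set (\<lambda>(n, i). cmod (\<phi> a \<xi> n i j)) G \<le> C * op_norm Q a" by (simp add: T_def)
  qed
  then show ?thesis by blast
qed

end

theorem mainTheorem3:
  fixes P Q :: "'a::countable \<Rightarrow> 'a \<Rightarrow> real"
    and \<phi> :: "('a fock_vec \<Rightarrow> 'a fock_vec) \<Rightarrow> ('a fock_vec \<Rightarrow> 'a fock_vec)"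
  assumes "stochastic P" and "stochastic Q"
    and "alg_iso Q P \<phi>"
  shows "\<exists>C. \<forall>T\<in>tensor_alg Q. op_norm P (\<phi> T) \<le> C * op_norm Q T"
  by (rule alg_iso_bounded[OF assms(1,3)])

end
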